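(* Let $X,X',Y,Y'$ be graphs with maximal degree $\Delta$ and let $r_X:VX'\to VX$ and $r_Y:VY\to VY'$ be $\kappa$-regular maps. Then for every $k$ such that $\operatorname{wir}^k_{X\to Y}$ takes finite values there is some $l$ such that for all $n$ $$\operatorname{wir}^l_{X\to Y'}(n)\leq\left(\kappa+\tfrac12\right)\Delta\cdot\operatorname{wir}^k_{X\to Y}(n)$$ and $$\operatorname{wir}^l_{X'\to Y'}(n)\leq\left(\kappa+\tfrac12\right)\Delta\cdot\operatorname{wir}^k_{X\to Y}\left(\left(\kappa+\tfrac12\right)\Delta n\right).$$
   Context: A graph $\Gamma=(V\Gamma,E\Gamma)$ consists of a set $V\Gamma$ of vertices and a set $E\Gamma$ of unordered pairs of distinct vertices (edges). $\Gamma$ also denotes its topological realisation (one unit interval for each edge, with endpoints labelled by the same vertex identified). $|\Gamma|$ is the number of vertices, and $\Gamma\leq X$ means $\Gamma$ is a subgraph of $X$. Vertex sets carry the shortest path metric. For metric spaces $A,B$ and $\kappa>0$, a map $r:A\to B$ is $\kappa$-regular if (1) $d_B(r(x),r(x'))\leq\kappa(1+d_A(x,x'))$ for all $x,x'\in A$, and (2) the preimage of every ball of radius $1$ in $B$ is contained in a union of at most $\kappa$ balls of radius $1$ in $A$. A wiring of a graph $\Gamma$ into a graph $\Gamma'$ is a continuous map $f:\Gamma\to\Gamma'$ such that the image of each vertex is a vertex and the image of each edge is a walk in $\Gamma'$. It is a coarse $k$-wiring if (1) the preimage of each vertex of $\Gamma'$ contains at most $k$ vertices of $\Gamma$, and (2)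 each edge of $\Gamma'$ is contained in the image of at most $k$ edges of $\Gamma$. The image of a wiring is the subgraph of $\Gamma'$ consisting of all vertices in $f(V\Gamma)$ and all walks which are images of edges; the volume of a wiring is the number of vertices in its image. For a finite graph $\Gamma$ and a graph $Y$, $\operatorname{wir}^k(\Gamma\to Y)$ is the minimal volume of a coarse $k$-wiring of $\Gamma$ into $Y$ ($+\infty$ if none exists). The $k$-wiring profile of $X$ into $Y$ is $\operatorname{wir}^k_{X\to Y}(t)=\max\{\operatorname{wir}^k(\Gamma\to Y) : \Gamma\leq X,\ |\Gamma|\leq t\}$, for real $t$ large enough that such $\Gamma$ exist.
   Formalization: The maximal degree Δ is assumed to be at least 1; for Δ = 0 the right-hand sides vanish and the claim fails already when all four graphs are a single vertex. *)

theory Defs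
  imports "HOL-Analysis.Analysis"
begin

section \<open>Graphs\<close>

datatype 'a ugraph = UGraph (verts: "'a set") (edges: "'a set set")

definition graph :: "'a ugraph \<Rightarrow> bool" where
  "graph G \<longleftrightarrow> (\<forall>e\<in>edges G. e \<subseteq> verts G \<and> card e = 2)"

definition subgraph :: "'a ugraph \<Rightarrow> 'a ugraph \<Rightarrow> bool" where
  "subgraph H G \<longleftrightarrow> graph H \<and> verts H \<subseteq> verts G \<and> edges H \<subseteq> edges G"

definition max_degree_le :: "'a ugraph \<Rightarrow> nat \<Rightarrow> bool" where
  "max_degree_le G d \<longleftrightarrow>
     (\<forall>v\<in>verts G. finite {e \<in> edges G. v \<in> e} \<and> card {e \<in> edges G. v \<in> e} \<le> d)"

text \<open>A walk is given by its sequence of vertices; a single vertex is a walk of length 0.\<close>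

definition walk :: "'a ugraph \<Rightarrow> 'a list \<Rightarrow> bool" where
  "walk G p \<longleftrightarrow> p \<noteq> [] \<and> set p \<subseteq> verts G \<and> (\<forall>i. Suc i < length p \<longrightarrow> {p ! i, p ! Suc i} \<in> edges G)"

definition walk_edges :: "'a list \<Rightarrow> 'a set set" where
  "walk_edges p = {{p ! i, p ! Suc i} | i. Suc i < length p}"

text \<open>The shortest path metric. Vertices in different components are at distance \<open>\<infinity>\<close>.\<close>

definition gdist :: "'a ugraph \<Rightarrow> 'a \<Rightarrow> 'a \<Rightarrow> ereal" where
  "gdist G u v =
     (INF p\<in>{p. walk G p \<and> hd p = u \<and> last p = v}. ereal (real (length p - 1)))"

section \<open>Regular maps\<close>

text \<open>
  Balls are closed: in a vertex set with the shortest path metric, open balls of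
  radius 1 are single points.
\<close>

definition closed_ball :: "'a set \<Rightarrow> ('a \<Rightarrow> 'a \<Rightarrow> ereal) \<Rightarrow> 'a \<Rightarrow> ereal \<Rightarrow> 'a set" where
  "closed_ball A d x \<rho> = {y \<in> A. d x y \<le> \<rho>}"

definition regular_map ::
    "real \<Rightarrow> 'a set \<Rightarrow> ('a \<Rightarrow> 'a \<Rightarrow> ereal) \<Rightarrow> 'b set \<Rightarrow> ('b \<Rightarrow> 'b \<Rightarrow> ereal) \<Rightarrow> ('a \<Rightarrow> 'b) \<Rightarrow> bool" where
  "regular_map \<kappa> A dA B dB r \<longleftrightarrow>
     r ` A \<subseteq> B \<and>
     (\<forall>x\<in>A. \<forall>x'\<in>A. dB (r x) (r x') \<le> ereal \<kappa> * (1 + dA x x')) \<and>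
     (\<forall>b\<in>B. \<exists>C\<subseteq>A. finite C \<and> real (card C) \<le> \<kappa> \<and>
        {x \<in> A. r x \<in> closed_ball B dB b 1} \<subseteq> (\<Union>c\<in>C. closed_ball A dA c 1))"

section \<open>Topological realisation\<close>

text \<open>
  Points of the realisation are written in barycentric coordinates, as functions on vertices.
  The map \<open>edge_point u v\<close> is the parametrisation of the edge \<open>{u, v}\<close> by the unit
  interval that starts at \<open>u\<close>; the definition does not depend on the orientation because
  \<open>edge_point v u t = edge_point u v (1 - t)\<close>.
\<close>

definition vertex_point :: "'a \<Rightarrow> 'a \<Rightarrow> real" where
  "vertex_point v = (\<lambda>w. of_bool (w = v))"

definition edge_point :: "'a \<Rightarrow> 'a \<Rightarrow> real \<Rightarrow> 'a \<Rightarrow> real" where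
  "edge_point u v t = (\<lambda>w. (1 - t) * vertex_point u w + t * vertex_point v w)"

definition edge_seg :: "'a set \<Rightarrow> ('a \<Rightarrow> real) set" where
  "edge_seg e = {edge_point u v t | u v t. e = {u, v} \<and> t \<in> {0..1}}"

definition realisation_carrier :: "'a ugraph \<Rightarrow> ('a \<Rightarrow> real) set" where
  "realisation_carrier G = vertex_point ` verts G \<union> (\<Union>e\<in>edges G. edge_seg e)"

text \<open>
  The quotient topology from the disjoint union of the vertices and one unit interval per edge.
\<close>

definition realisation :: "'a ugraph \<Rightarrow> ('a \<Rightarrow> real) topology" where
  "realisation G = topology (\<lambda>U. U \<subseteq> realisation_carrier G \<and>
     (\<forall>u v. {u, v} \<in> edges G \<longrightarrow>
        openin (top_of_set {0..1::real}) {t \<in> {0..1}. edge_point u v t \<in> U}))"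

lemma openin_realisation:
  "openin (realisation G) U \<longleftrightarrow> U \<subseteq> realisation_carrier G \<and>
     (\<forall>u v. {u, v} \<in> edges G \<longrightarrow>
        openin (top_of_set {0..1::real}) {t \<in> {0..1}. edge_point u v t \<in> U})"
proof -
  let ?P = "\<lambda>U. U \<subseteq> realisation_carrier G \<and>
     (\<forall>u v. {u, v} \<in> edges G \<longrightarrow>
        openin (top_of_set {0..1::real}) {t \<in> {0..1}. edge_point u v t \<in> U})"
  have "istopology ?P"
    unfolding istopology_def
  proof (intro conjI allI impI)
    fix S T assume ST: "?P S" "?P T"
    show "S \<inter> T \<subseteq> realisation_carrier G" using ST by blast
    fix u v assume "{u, v} \<in> edges G"
    then have "openin (top_of_set {0..1::real})
        ({t \<in> {0..1}. edge_point u v t \<in> S} \<inter> {t \<in> {0..1}. edge_point u v t \<in> T})"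
      using ST by (intro openin_Int) auto
    moreover have "{t \<in> {0..1}. edge_point u v t \<in> S} \<inter> {t \<in> {0..1}. edge_point u v t \<in> T}
        = {t \<in> {0..1}. edge_point u v t \<in> S \<inter> T}" by blast
    ultimately show "openin (top_of_set {0..1::real}) {t \<in> {0..1}. edge_point u v t \<in> S \<inter> T}"
      by simp
  next
    fix K assume K: "\<forall>S\<in>K. ?P S"
    show "\<Union>K \<subseteq> realisation_carrier G" using K by blast
    fix u v assume "{u, v} \<in> edges G"
    then have "openin (top_of_set {0..1::real}) (\<Union>S\<in>K. {t \<in> {0..1}. edge_point u v t \<in> S})"
      using K by (intro openin_Union) auto
    moreover have "(\<Union>S\<in>K. {t \<in> {0..1}. edge_point u v t \<in> S})
        = {t \<in> {0..1}. edge_point u v t \<in> \<Union>K}" by blast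
    ultimately show "openin (top_of_set {0..1::real}) {t \<in> {0..1}. edge_point u v t \<in> \<Union>K}"
      by simp
  qed
  then show ?thesis by (simp add: realisation_def topology_inverse')
qed

definition walk_seg :: "'a list \<Rightarrow> ('a \<Rightarrow> real) set" where
  "walk_seg p = vertex_point ` set p \<union> (\<Union>e\<in>walk_edges p. edge_seg e)"

section \<open>Wirings\<close>

definition wiring :: "'a ugraph \<Rightarrow> 'b ugraph \<Rightarrow> (('a \<Rightarrow> real) \<Rightarrow> ('b \<Rightarrow> real)) \<Rightarrow> bool" where
  "wiring G H f \<longleftrightarrow>
     continuous_map (realisation G) (realisation H) f \<and>
     (\<forall>v\<in>verts G. f (vertex_point v) \<in> vertex_point ` verts H) \<and>
     (\<forall>e\<in>edges G. \<exists>p. walk H p \<and> f ` edge_seg e = walk_seg p)"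

definition coarse_wiring ::
    "nat \<Rightarrow> 'a ugraph \<Rightarrow> 'b ugraph \<Rightarrow> (('a \<Rightarrow> real) \<Rightarrow> ('b \<Rightarrow> real)) \<Rightarrow> bool" where
  "coarse_wiring k G H f \<longleftrightarrow>
     wiring G H f \<and>
     (\<forall>w\<in>verts H. finite {v \<in> verts G. f (vertex_point v) = vertex_point w} \<and>
        card {v \<in> verts G. f (vertex_point v) = vertex_point w} \<le> k) \<and>
     (\<forall>e'\<in>edges H. finite {e \<in> edges G. edge_seg e' \<subseteq> f ` edge_seg e} \<and>
        card {e \<in> edges G. edge_seg e' \<subseteq> f ` edge_seg e} \<le> k)"

text \<open>
  Since the image of an edge is the realisation of a walk, the vertices and edges of that walk
  are exactly those whose realisations lie in the image of the edge.
\<close>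

definition wiring_image ::
    "'a ugraph \<Rightarrow> 'b ugraph \<Rightarrow> (('a \<Rightarrow> real) \<Rightarrow> ('b \<Rightarrow> real)) \<Rightarrow> 'b ugraph" where
  "wiring_image G H f = UGraph
     {w \<in> verts H. (\<exists>v\<in>verts G. f (vertex_point v) = vertex_point w) \<or>
                   (\<exists>e\<in>edges G. vertex_point w \<in> f ` edge_seg e)}
     {e' \<in> edges H. \<exists>e\<in>edges G. edge_seg e' \<subseteq> f ` edge_seg e}"

text \<open>Only used for finite \<open>G\<close>, when the image of a wiring is finite.\<close>

definition volume :: "'a ugraph \<Rightarrow> 'b ugraph \<Rightarrow> (('a \<Rightarrow> real) \<Rightarrow> ('b \<Rightarrow> real)) \<Rightarrow> nat" where
  "volume G H f = card (verts (wiring_image G H f))"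

definition wir :: "nat \<Rightarrow> 'a ugraph \<Rightarrow> 'b ugraph \<Rightarrow> enat" where
  "wir k G Y = (INF f\<in>{f. coarse_wiring k G Y f}. enat (volume G Y f))"

text \<open>
  If \<open>X\<close> has bounded degree, only finitely many isomorphism types of graphs occur in the
  supremum, so it is a maximum. The empty graph is a subgraph of every graph, so the profile
  is defined for all \<open>t \<ge> 0\<close>.
\<close>

definition wir_profile :: "nat \<Rightarrow> 'a ugraph \<Rightarrow> 'b ugraph \<Rightarrow> real \<Rightarrow> enat" where
  "wir_profile k X Y t =
     (SUP G\<in>{G. subgraph G X \<and> finite (verts G) \<and> real (card (verts G)) \<le> t}. wir k G Y)"

end

(*
  A wiring amounts to a map of vertices together with a choice of a walk for every edge.
  In this combinatorial form wirings compose, with multiplicities multiplying. A k-regular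
  map (k = kappa) between graphs of bounded degree is itself such a wiring: the ends of an
  edge are at distance at most 1, so their images are joined by a walk of length at most 2k,
  and bounded degree bounds the multiplicities. For S a finite set of vertices, at most
  D|S|/2 edges have both ends in S (D the degree bound), and each of them adds at most 2k - 1
  interior vertices, so the image has at most |S| + D|S|(2k - 1)/2 <= (k + 1/2) D |S|
  vertices. Composing an optimal wiring into Y with the wiring of Y into Y' gives the first
  inequality. For the second, a subgraph of X' is first wired onto a subgraph of X.
  If k < 1, regularity forces X' and Y to be empty, and finiteness of the profile then forces
  X to be empty.
*)

theory Submission
  imports Defs
begin

section \<open>Walks\<close>

lemma walk_edges_simps [simp]:
  "walk_edges [] = {}"
  "walk_edges [x] = {}"
  "walk_edges (x # y # p) = insert {x, y} (walk_edges (y # p))"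
proof -
  show "walk_edges [] = {}" "walk_edges [x] = {}" by (auto simp: walk_edges_def)
  show "walk_edges (x # y # p) = insert {x, y} (walk_edges (y # p))"
  proof (intro set_eqI iffI)
    fix e assume "e \<in> walk_edges (x # y # p)"
    then obtain i where i: "Suc i < length (x # y # p)"
        "e = {(x # y # p) ! i, (x # y # p) ! Suc i}"
      by (auto simp: walk_edges_def)
    then show "e \<in> insert {x, y} (walk_edges (y # p))"
      by (cases i) (auto simp: walk_edges_def)
  next
    fix e assume "e \<in> insert {x, y} (walk_edges (y # p))"
    then consider "e = {x, y}" | i where "Suc i < length (y # p)" "e = {(y # p) ! i, (y # p) ! Suc i}"
      by (auto simp: walk_edges_def)
    then show "e \<in> walk_edges (x # y # p)"
    proof cases
      case 1
      then show ?thesis by (auto simp: walk_edges_def intro!: exI[of _ 0])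
    next
      case (2 i)
      then show ?thesis by (auto simp: walk_edges_def intro!: exI[of _ "Suc i"])
    qed
  qed
qed

lemma walk_iff: "walk G p \<longleftrightarrow> p \<noteq> [] \<and> set p \<subseteq> verts G \<and> walk_edges p \<subseteq> edges G"
  by (auto simp: walk_def walk_edges_def)

lemma walk_hd_in_verts: "walk G p \<Longrightarrow> hd p \<in> verts G"
  by (cases p) (auto simp: walk_iff)

lemma walk_edges_append:
  "p \<noteq> [] \<Longrightarrow> q \<noteq> [] \<Longrightarrow>
   walk_edges (p @ q) = insert {last p, hd q} (walk_edges p \<union> walk_edges q)"
proof (induction p)
  case (Cons x p)
  show ?case
  proof (cases p)
    case Nil
    with Cons.prems show ?thesis by (cases q) auto
  next
    case (Cons y p')
    with Cons.IH Cons.prems show ?thesis by auto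
  qed
qed simp

text \<open>Dropping the head of \<open>q\<close> keeps the common vertex once; the edge created at
  the junction is then the first edge of \<open>q\<close>.\<close>

lemma walk_edges_join:
  assumes "p \<noteq> []" "q \<noteq> []" "last p = hd q"
  shows "walk_edges (p @ tl q) = walk_edges p \<union> walk_edges q"
proof (cases "tl q = []")
  case True
  with assms show ?thesis by (cases q) auto
next
  case False
  with assms obtain y z r where "q = y # z # r" by (metis list.exhaust list.sel(3))
  with assms show ?thesis by (auto simp: walk_edges_append)
qed

lemma walk_edges_rev: "walk_edges (rev p) = walk_edges p"
proof (induction p)
  case (Cons x p)
  show ?case
  proof (cases p)
    case p: (Cons y r)
    have "walk_edges (rev p @ [x]) = insert {last (rev p), x} (walk_edges (rev p))"
      using p by (subst walk_edges_append) auto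
    then show ?thesis
      using Cons.IH p by (simp add: insert_commute)
  qed simp
qed simp

lemma walk_edges_subset_set: "e \<in> walk_edges p \<Longrightarrow> e \<subseteq> set p"
  by (auto simp: walk_edges_def)

lemma walk_rev: "walk G p \<Longrightarrow> walk G (rev p)"
  by (simp add: walk_iff walk_edges_rev)

lemma walk_edges_take: "walk_edges (take n p) \<subseteq> walk_edges p"
  by (fastforce simp: walk_edges_def)

lemma walk_edges_drop: "walk_edges (drop n p) \<subseteq> walk_edges p"
proof
  fix e assume "e \<in> walk_edges (drop n p)"
  then obtain i where "Suc i < length p - n" "e = {p ! (n + i), p ! Suc (n + i)}"
    by (auto simp: walk_edges_def)
  then show "e \<in> walk_edges p"
    by (auto simp: walk_edges_def intro!: exI[of _ "n + i"])
qed

text \<open>Cuts a vertex list between two positions. If the list is a walk, so is the piece,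
  because its vertices and edges are among the old ones.\<close>

lemma subwalk:
  assumes "i \<le> j" "j < length p"
  obtains q where "q \<noteq> []" "hd q = p ! i" "last q = p ! j" "set q \<subseteq> set p"
    "walk_edges q \<subseteq> walk_edges p" "length q = Suc j - i"
proof
  let ?q = "drop i (take (Suc j) p)"
  show "?q \<noteq> []" using assms by simp
  show "hd ?q = p ! i" using assms by (simp add: hd_drop_conv_nth)
  show "last ?q = p ! j" using assms by (simp add: last_conv_nth)
  show "set ?q \<subseteq> set p" by (meson set_drop_subset set_take_subset subset_trans)
  show "walk_edges ?q \<subseteq> walk_edges p" by (meson walk_edges_drop walk_edges_take subset_trans)
  show "length ?q = Suc j - i" using assms by simp
qed

section \<open>Points of the realisation\<close>

lemma vertex_point_inject [simp]: "vertex_point u = vertex_point v \<longleftrightarrow> u = v"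
  by (auto simp: vertex_point_def fun_eq_iff)

lemma edge_point_0 [simp]: "edge_point u v 0 = vertex_point u"
  and edge_point_1 [simp]: "edge_point u v 1 = vertex_point v"
  by (auto simp: edge_point_def)

lemma edge_point_swap: "edge_point v u t = edge_point u v (1 - t)"
  by (auto simp: edge_point_def)

text \<open>The edge that contains an interior point can thus be read off from the point
  itself.\<close>

lemma edge_point_support:
  "u \<noteq> v \<Longrightarrow> 0 < t \<Longrightarrow> t < 1 \<Longrightarrow> {w. edge_point u v t w \<noteq> 0} = {u, v}"
  by (auto simp: edge_point_def vertex_point_def)

lemma edge_point_support_subset: "{w. edge_point u v t w \<noteq> 0} \<subseteq> {u, v}"
  by (auto simp: edge_point_def vertex_point_def)

lemma vertex_point_support: "{w. vertex_point u w \<noteq> 0} = {u}"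
  by (auto simp: vertex_point_def)

lemma edge_point_at: "u \<noteq> v \<Longrightarrow> edge_point u v t v = t"
  by (auto simp: edge_point_def vertex_point_def)

lemma edge_seg_pair: "edge_seg {u, v} = edge_point u v ` {0..1}"
proof (intro set_eqI iffI)
  fix x assume "x \<in> edge_seg {u, v}"
  then obtain a b t where *: "{u, v} = {a, b}" "t \<in> {0..1}" "x = edge_point a b t"
    by (auto simp: edge_seg_def)
  then consider "u = a" "v = b" | "u = b" "v = a" by (auto simp: doubleton_eq_iff)
  then show "x \<in> edge_point u v ` {0..1}"
  proof cases
    case 1
    show ?thesis using *(2,3) unfolding 1 by (rule rev_image_eqI)
  next
    case 2
    have "x = edge_point u v (1 - t)" using *(3) unfolding 2 by (simp add: edge_point_swap[of a])
    moreover have "1 - t \<in> {0..1}" using *(2) by simp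
    ultimately show ?thesis by (rule image_eqI)
  qed
qed (unfold edge_seg_def, blast)

lemma vertex_point_in_edge_seg: "u \<in> {a, b} \<Longrightarrow> vertex_point u \<in> edge_seg {a, b}"
  unfolding edge_seg_pair by (metis atLeastAtMost_iff edge_point_0 edge_point_1 empty_iff
      image_eqI insert_iff order_refl zero_le_one)

lemma walk_seg_simps [simp]:
  "walk_seg [x] = {vertex_point x}"
  "walk_seg (x # y # p) = edge_seg {x, y} \<union> walk_seg (y # p)"
  by (auto simp: walk_seg_def vertex_point_in_edge_seg)

text \<open>The support of a point of an edge is contained in that edge, so a vertex point on an
  edge is one of its ends.\<close>

lemma vertex_point_in_walk_seg_iff: "vertex_point w \<in> walk_seg p \<longleftrightarrow> w \<in> set p"
proof
  assume "vertex_point w \<in> walk_seg p"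
  then consider "w \<in> set p" | e where "e \<in> walk_edges p" "vertex_point w \<in> edge_seg e"
    by (auto simp: walk_seg_def)
  then show "w \<in> set p"
  proof cases
    case (2 e)
    then obtain u v t where "e = {u, v}" "vertex_point w = edge_point u v t"
      by (auto simp: edge_seg_def)
    with edge_point_support_subset[of u v t] have "w \<in> e"
      by (metis insert_subset vertex_point_support)
    with 2 show ?thesis using walk_edges_subset_set by auto
  qed
qed (auto simp: walk_seg_def)

text \<open>The midpoint of \<open>e\<close> has support exactly \<open>e\<close>; hence it is no
  vertex point and lies on no edge other than \<open>e\<close>.\<close>

lemma edge_seg_subset_walk_seg_iff:
  assumes "card e = 2"
  shows "edge_seg e \<subseteq> walk_seg p \<longleftrightarrow> e \<in> walk_edges p"
proof
  obtain u v where e: "e = {u, v}" "u \<noteq> v" using assms by (auto simp: card_2_iff)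
  let ?m = "edge_point u v (1/2)"
  have supp: "{w. ?m w \<noteq> 0} = e" using e by (simp add: edge_point_support)
  assume "edge_seg e \<subseteq> walk_seg p"
  moreover have "?m \<in> edge_seg e" unfolding e edge_seg_pair by auto
  ultimately have "?m \<in> walk_seg p" by blast
  then consider w where "?m = vertex_point w" | a where "a \<in> walk_edges p" "?m \<in> edge_seg a"
    by (auto simp: walk_seg_def)
  then show "e \<in> walk_edges p"
  proof cases
    case (1 w)
    with supp vertex_point_support[of w] have "e = {w}" by simp
    with assms show ?thesis by simp
  next
    case (2 a)
    then obtain x y t where a: "a = {x, y}" "?m = edge_point x y t"
      by (auto simp: edge_seg_def)
    with supp edge_point_support_subset[of x y t] have "e \<subseteq> {x, y}" by simp
    with e a have "e = a" by auto
    with 2 show ?thesis by simp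
  qed
qed (auto simp: walk_seg_def)

section \<open>Topology of the realisation and paths along walks\<close>

lemma topspace_realisation [simp]: "topspace (realisation G) = realisation_carrier G"
proof -
  have "openin (realisation G) (realisation_carrier G)"
    unfolding openin_realisation
  proof (intro conjI allI impI)
    fix u v assume "{u, v} \<in> edges G"
    then have "{t \<in> {0..1}. edge_point u v t \<in> realisation_carrier G} = {0..1}"
      by (auto simp: realisation_carrier_def edge_seg_def)
    then show "openin (top_of_set {0..1}) {t \<in> {0..1}. edge_point u v t \<in> realisation_carrier G}"
      by simp
  qed simp
  then show ?thesis
    by (meson openin_realisation openin_subset openin_topspace subset_antisym)
qed

lemma pathin_edge_point:
  assumes "{u, v} \<in> edges G"
  shows "pathin (realisation G) (edge_point u v)"
  unfolding pathin_def continuous_map_def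
  using assms by (auto simp: openin_realisation realisation_carrier_def edge_seg_def)

text \<open>This is the universal property of the quotient topology. One orientation for each edge
  is enough, since reversal \<open>t \<mapsto> 1 - t\<close> is continuous.\<close>

lemma continuous_map_from_realisation:
  assumes vert: "\<And>v. v \<in> verts G \<Longrightarrow> F (vertex_point v) \<in> topspace Z"
    and edge: "\<And>e. e \<in> edges G \<Longrightarrow> \<exists>u v. e = {u, v} \<and> pathin Z (\<lambda>t. F (edge_point u v t))"
  shows "continuous_map (realisation G) Z F"
proof -
  have path: "pathin Z (\<lambda>t. F (edge_point u v t))" if uv: "{u, v} \<in> edges G" for u v
  proof -
    obtain a b where ab: "{u, v} = {a, b}" and p: "pathin Z (\<lambda>t. F (edge_point a b t))"
      using edge[OF uv] by blast
    from ab consider "u = a" "v = b" | "u = b" "v = a" by (auto simp: doubleton_eq_iff)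
    then show ?thesis
    proof cases
      case 2
      have "continuous_map (top_of_set {0..1}) (top_of_set {0..1}) (\<lambda>t::real. 1 - t)"
        by (auto intro!: continuous_intros)
      from continuous_map_compose[OF this p[unfolded pathin_def]] show ?thesis
        using 2 by (simp add: pathin_def o_def edge_point_swap[of b a])
    qed (use p in simp)
  qed
  show ?thesis
    unfolding continuous_map_def
  proof (intro conjI allI impI)
    show "F \<in> topspace (realisation G) \<rightarrow> topspace Z"
    proof
      fix x assume "x \<in> topspace (realisation G)"
      then consider v where "v \<in> verts G" "x = vertex_point v"
        | u v t where "{u, v} \<in> edges G" "t \<in> {0..1}" "x = edge_point u v t"
        by (auto simp: realisation_carrier_def edge_seg_def)
      then show "F x \<in> topspace Z"
      proof cases
        case (2 u v t)
        from continuous_map_image_subset_topspace[OF path[OF 2(1), unfolded pathin_def]] 2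
        show ?thesis by auto
      qed (use vert in auto)
    qed
    fix U assume U: "openin Z U"
    show "openin (realisation G) {x \<in> topspace (realisation G). F x \<in> U}"
      unfolding openin_realisation
    proof (intro conjI allI impI)
      fix u v assume uv: "{u, v} \<in> edges G"
      have "{t \<in> {0..1}. edge_point u v t \<in> {x \<in> topspace (realisation G). F x \<in> U}}
          = {t \<in> topspace (top_of_set {0..1}). F (edge_point u v t) \<in> U}"
        using uv by (auto simp: realisation_carrier_def edge_seg_def)
      then show "openin (top_of_set {0..1})
          {t \<in> {0..1}. edge_point u v t \<in> {x \<in> topspace (realisation G). F x \<in> U}}"
        using path[OF uv] U by (simp add: pathin_def continuous_map_def)
    qed auto
  qed
qed

text \<open>The usual concatenation, with each path run at double speed.\<close>

lemma pathin_join: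
  assumes "pathin X g" "pathin X h" "g 1 = h 0"
  obtains \<gamma> where "pathin X \<gamma>" "\<gamma> 0 = g 0" "\<gamma> 1 = h 1" "\<gamma> ` {0..1} = g ` {0..1} \<union> h ` {0..1}"
proof
  let ?\<gamma> = "\<lambda>t::real. if t \<le> 1/2 then g (2 * t) else h (2 * t - 1)"
  \<comment> \<open>The pasting rule used below speaks of subtopologies cut out by inequalities;
    they are first identified with the two half intervals.\<close>
  have "{t \<in> topspace (top_of_set {0..1::real}). t \<le> 1/2} = {0..1/2}"
    "{t \<in> topspace (top_of_set {0..1::real}). 1/2 \<le> t} = {1/2..1}" by auto
  then have eq: "subtopology (top_of_set {0..1::real}) {t \<in> topspace (top_of_set {0..1}). t \<le> 1/2}
        = top_of_set {0..1/2}"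
    "subtopology (top_of_set {0..1::real}) {t \<in> topspace (top_of_set {0..1}). 1/2 \<le> t}
        = top_of_set {1/2..1}"
    by (simp_all add: subtopology_subtopology Int_absorb1)
  have "continuous_map (top_of_set {0..1/2}) (top_of_set {0..1}) (\<lambda>t::real. 2 * t)"
    "continuous_map (top_of_set {1/2..1}) (top_of_set {0..1}) (\<lambda>t::real. 2 * t - 1)"
    by (auto intro!: continuous_intros)
  then have sub: "continuous_map (top_of_set {0..1/2}) X (\<lambda>t. g (2 * t))"
    "continuous_map (top_of_set {1/2..1}) X (\<lambda>t. h (2 * t - 1))"
    using continuous_map_compose[of _ _ _ X g] continuous_map_compose[of _ _ _ X h] assms(1,2)
    unfolding pathin_def o_def by blast+
  show "pathin X ?\<gamma>"
    unfolding pathin_def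
  proof (rule continuous_map_cases_le)
    show "g (2 * t) = h (2 * t - 1)" if "t = 1/2" for t unfolding that using assms(3) by simp
  qed (simp_all only: eq sub, auto intro: continuous_intros)
  show "?\<gamma> 0 = g 0" "?\<gamma> 1 = h 1" by auto
  show "?\<gamma> ` {0..1} = g ` {0..1} \<union> h ` {0..1}"
  proof (intro set_eqI iffI)
    fix x assume "x \<in> g ` {0..1} \<union> h ` {0..1}"
    then consider t where "t \<in> {0..1}" "x = g t" | t where "t \<in> {0..1}" "x = h t" by auto
    then show "x \<in> ?\<gamma> ` {0..1}"
    proof cases
      case (1 t)
      then show ?thesis by (intro image_eqI[of _ _ "t/2"]) auto
    next
      case (2 t)
      then show ?thesis using assms(3) by (intro image_eqI[of _ _ "(t+1)/2"]) (auto simp: field_simps)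
    qed
  qed auto
qed

text \<open>The parametrisations of successive edges are concatenated. A walk of length 0 gives a
  constant path, so an edge may be collapsed to a vertex.\<close>

lemma walk_path:
  assumes "walk H p"
  obtains \<gamma> where "pathin (realisation H) \<gamma>" "\<gamma> 0 = vertex_point (hd p)"
    "\<gamma> 1 = vertex_point (last p)" "\<gamma> ` {0..1} = walk_seg p"
proof -
  have "\<exists>\<gamma>. pathin (realisation H) \<gamma> \<and> \<gamma> 0 = vertex_point (hd p) \<and>
    \<gamma> 1 = vertex_point (last p) \<and> \<gamma> ` {0..1} = walk_seg p"
    using assms
  proof (induction p rule: induct_list012)
    case (2 x)
    show ?case
    proof (intro exI conjI)
      show "pathin (realisation H) (\<lambda>t. vertex_point x)"
        using 2 by (simp add: walk_iff realisation_carrier_def)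
      show "(\<lambda>t. vertex_point x) ` {0..1::real} = walk_seg [x]"
        by (simp add: image_constant_conv)
    qed simp_all
  next
    case (3 x y p)
    from "3.prems" have yp: "walk H (y # p)" and xy: "{x, y} \<in> edges H" by (auto simp: walk_iff)
    from "3.IH"(2)[OF yp] obtain h where h: "pathin (realisation H) h" "h 0 = vertex_point y"
        "h 1 = vertex_point (last (y # p))" "h ` {0..1} = walk_seg (y # p)"
      unfolding list.sel by (elim exE conjE)
    have "edge_point x y 1 = h 0" by (simp add: h)
    then obtain \<gamma> where \<gamma>: "pathin (realisation H) \<gamma>" "\<gamma> 0 = edge_point x y 0"
        "\<gamma> 1 = h 1" "\<gamma> ` {0..1} = edge_point x y ` {0..1} \<union> h ` {0..1}"
      by (rule pathin_join[OF pathin_edge_point[OF xy] h(1)])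
    show ?case
    proof (intro exI conjI)
      show "pathin (realisation H) \<gamma>" by (rule \<gamma>)
      show "\<gamma> ` {0..1} = walk_seg (x # y # p)" by (simp only: \<gamma> h walk_seg_simps edge_seg_pair)
    qed (simp_all add: \<gamma> h)
  qed (simp add: walk_iff)
  then show thesis by (elim exE conjE) (rule that)
qed


section \<open>Discrete wirings\<close>

text \<open>
  The walk of an edge may be traversed in either direction, so \<open>u\<close> and \<open>v\<close> below are
  chosen to fit the walk.
\<close>

definition discrete_wiring ::
    "nat \<Rightarrow> 'a ugraph \<Rightarrow> 'b ugraph \<Rightarrow> ('a \<Rightarrow> 'b) \<Rightarrow> ('a set \<Rightarrow> 'b list) \<Rightarrow> bool" where
  "discrete_wiring k G H g q \<longleftrightarrow>
     g ` verts G \<subseteq> verts H \<and>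
     (\<forall>e\<in>edges G. walk H (q e) \<and> (\<exists>u v. e = {u, v} \<and> hd (q e) = g u \<and> last (q e) = g v)) \<and>
     (\<forall>w\<in>verts H. finite {v \<in> verts G. g v = w} \<and> card {v \<in> verts G. g v = w} \<le> k) \<and>
     (\<forall>a\<in>edges H. finite {e \<in> edges G. a \<in> walk_edges (q e)} \<and>
        card {e \<in> edges G. a \<in> walk_edges (q e)} \<le> k)"

text \<open>The combinatorial counterpart of the vertex set of \<open>wiring_image\<close>; its
  cardinality stands in for the volume.\<close>

definition discrete_image :: "'a ugraph \<Rightarrow> ('a \<Rightarrow> 'b) \<Rightarrow> ('a set \<Rightarrow> 'b list) \<Rightarrow> 'b set" where
  "discrete_image G g q = g ` verts G \<union> (\<Union>e\<in>edges G. set (q e))"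

lemma discrete_wiring_vertD: "discrete_wiring k G H g q \<Longrightarrow> v \<in> verts G \<Longrightarrow> g v \<in> verts H"
  by (auto simp: discrete_wiring_def)

lemma discrete_wiring_walkD: "discrete_wiring k G H g q \<Longrightarrow> e \<in> edges G \<Longrightarrow> walk H (q e)"
  by (auto simp: discrete_wiring_def)

lemma discrete_wiring_endsE:
  assumes "discrete_wiring k G H g q" "e \<in> edges G"
  obtains u v where "e = {u, v}" "hd (q e) = g u" "last (q e) = g v"
  using assms by (auto simp: discrete_wiring_def)

lemma discrete_wiring_vert_card:
  "discrete_wiring k G H g q \<Longrightarrow> w \<in> verts H \<Longrightarrow>
   finite {v \<in> verts G. g v = w} \<and> card {v \<in> verts G. g v = w} \<le> k"
  by (auto simp: discrete_wiring_def)

lemma discrete_wiring_edge_card: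
  "discrete_wiring k G H g q \<Longrightarrow> a \<in> edges H \<Longrightarrow>
   finite {e \<in> edges G. a \<in> walk_edges (q e)} \<and> card {e \<in> edges G. a \<in> walk_edges (q e)} \<le> k"
  by (auto simp: discrete_wiring_def)

lemma discrete_wiring_mono: "discrete_wiring k G H g q \<Longrightarrow> k \<le> l \<Longrightarrow> discrete_wiring l G H g q"
  unfolding discrete_wiring_def by (meson order_trans)

lemma discrete_wiring_subgraph:
  assumes "discrete_wiring k X H g q" "subgraph G X"
  shows "discrete_wiring k G H g q"
  unfolding discrete_wiring_def
proof (intro conjI ballI)
  have sub: "verts G \<subseteq> verts X" "edges G \<subseteq> edges X" using assms(2) by (auto simp: subgraph_def)
  show "g ` verts G \<subseteq> verts H" using assms(1) sub by (auto simp: discrete_wiring_def)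
  fix e assume "e \<in> edges G"
  with sub have e: "e \<in> edges X" by auto
  show "walk H (q e)" using assms(1) e by (rule discrete_wiring_walkD)
  show "\<exists>u v. e = {u, v} \<and> hd (q e) = g u \<and> last (q e) = g v"
    using discrete_wiring_endsE[OF assms(1) e] by blast
next
  fix w assume w: "w \<in> verts H"
  have sub: "{v \<in> verts G. g v = w} \<subseteq> {v \<in> verts X. g v = w}"
    using assms(2) by (auto simp: subgraph_def)
  note X = discrete_wiring_vert_card[OF assms(1) w]
  show "finite {v \<in> verts G. g v = w}" using X by (intro finite_subset[OF sub]) simp
  show "card {v \<in> verts G. g v = w} \<le> k" using X card_mono[OF _ sub] by fastforce
next
  fix a assume a: "a \<in> edges H"
  have sub: "{e \<in> edges G. a \<in> walk_edges (q e)} \<subseteq> {e \<in> edges X. a \<in> walk_edges (q e)}"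
    using assms(2) by (auto simp: subgraph_def)
  note X = discrete_wiring_edge_card[OF assms(1) a]
  show "finite {e \<in> edges G. a \<in> walk_edges (q e)}" using X by (intro finite_subset[OF sub]) simp
  show "card {e \<in> edges G. a \<in> walk_edges (q e)} \<le> k" using X card_mono[OF _ sub] by fastforce
qed

section \<open>From discrete wirings to continuous ones\<close>

lemma graph_edgeE:
  assumes "graph G" "e \<in> edges G"
  obtains u v where "e = {u, v}" "u \<noteq> v" "u \<in> verts G" "v \<in> verts G"
  using assms by (fastforce simp: graph_def card_2_iff)

lemma graph_finite_edges: "graph G \<Longrightarrow> finite (verts G) \<Longrightarrow> finite (edges G)"
  by (rule finite_subset[of _ "Pow (verts G)"]) (auto simp: graph_def)

text \<open>Every edge is mapped along a path that traces its walk. The segment of a walk contains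
  no vertices and edges besides those of the walk, so the counting conditions carry over and the
  image gains no vertices.\<close>

lemma discrete_wiring_realisable:
  assumes G: "graph G" and H: "graph H" and dw: "discrete_wiring k G H g q"
  obtains f where "coarse_wiring k G H f" "verts (wiring_image G H f) \<subseteq> discrete_image G g q"
proof -
  \<comment> \<open>\<open>f\<close> recognises the edge containing a non-vertex point \<open>x\<close> as the support of \<open>x\<close>,
    and the parameter of \<open>x\<close> on that edge as its coordinate at the final end.\<close>
  have "\<exists>u v \<gamma>. e = {u, v} \<and> pathin (realisation H) \<gamma> \<and> \<gamma> 0 = vertex_point (g u) \<and>
      \<gamma> 1 = vertex_point (g v) \<and> \<gamma> ` {0..1} = walk_seg (q e)" if e: "e \<in> edges G" for e
    using discrete_wiring_endsE[OF dw e] walk_path[OF discrete_wiring_walkD[OF dw e]] by metis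
  then obtain s t \<gamma> where st: "\<And>e. e \<in> edges G \<Longrightarrow> e = {s e, t e}"
    and \<gamma>: "\<And>e. e \<in> edges G \<Longrightarrow> pathin (realisation H) (\<gamma> e)"
      "\<And>e. e \<in> edges G \<Longrightarrow> \<gamma> e 0 = vertex_point (g (s e))"
      "\<And>e. e \<in> edges G \<Longrightarrow> \<gamma> e 1 = vertex_point (g (t e))"
      "\<And>e. e \<in> edges G \<Longrightarrow> \<gamma> e ` {0..1} = walk_seg (q e)"
    by metis
  define f where "f x = (if \<exists>v. x = vertex_point v then vertex_point (g (THE v. x = vertex_point v))
      else \<gamma> {w. x w \<noteq> 0} (x (t {w. x w \<noteq> 0})))" for x
  have f_vert: "f (vertex_point v) = vertex_point (g v)" for v
    by (auto simp: f_def)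
  have f_edge: "f (edge_point (s e) (t e) c) = \<gamma> e c" if e: "e \<in> edges G" and c: "c \<in> {0..1}" for e c
  proof -
    have ne: "s e \<noteq> t e"
    proof
      assume "s e = t e"
      then have "e = {s e}" using st[OF e] by simp
      then have "card e = 1" by (metis is_singletonI is_singleton_altdef)
      with G e show False by (simp add: graph_def)
    qed
    \<comment> \<open>At the two ends the vertex clause of \<open>f\<close> applies, and the chosen
      path has the matching end points.\<close>
    consider "c = 0" | "c = 1" | "0 < c" "c < 1" using c by fastforce
    then show ?thesis
    proof cases
      case 3
      have supp: "{w. edge_point (s e) (t e) c w \<noteq> 0} = e"
        using edge_point_support[OF ne 3] st[OF e] by simp
      have "edge_point (s e) (t e) c \<noteq> vertex_point v" for v
      proof
        assume "edge_point (s e) (t e) c = vertex_point v"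
        with supp have "{v} = {s e, t e}" using vertex_point_support[of v] st[OF e] by simp
        with ne show False by auto
      qed
      then show ?thesis unfolding f_def supp edge_point_at[OF ne] by simp
    next
      case 1
      with \<gamma>(2)[OF e] show ?thesis by (simp add: f_vert)
    next
      case 2
      with \<gamma>(3)[OF e] show ?thesis by (simp add: f_vert)
    qed
  qed
  have f_seg: "f ` edge_seg e = walk_seg (q e)" if e: "e \<in> edges G" for e
  proof -
    have "f ` edge_seg e = f ` edge_point (s e) (t e) ` {0..1}"
      using st[OF e] edge_seg_pair by metis
    also have "\<dots> = \<gamma> e ` {0..1}" using f_edge[OF e] by (simp add: image_image)
    finally show ?thesis using \<gamma> e by simp
  qed
  have "wiring G H f"
    unfolding wiring_def
  proof (intro conjI ballI)
    show "continuous_map (realisation G) (realisation H) f"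
    proof (rule continuous_map_from_realisation)
      fix v assume "v \<in> verts G"
      then show "f (vertex_point v) \<in> topspace (realisation H)"
        using discrete_wiring_vertD[OF dw] by (auto simp: f_vert realisation_carrier_def)
    next
      fix e assume e: "e \<in> edges G"
      have "pathin (realisation H) (\<lambda>c. f (edge_point (s e) (t e) c))"
        using \<gamma>(1)[OF e] unfolding pathin_def
        by (rule continuous_map_eq) (auto simp: f_edge[OF e])
      then show "\<exists>u v. e = {u, v} \<and> pathin (realisation H) (\<lambda>t. f (edge_point u v t))"
        using st[OF e] by blast
    qed
  qed (use discrete_wiring_vertD[OF dw] discrete_wiring_walkD[OF dw] in \<open>auto simp: f_vert f_seg\<close>)
  moreover have "{e \<in> edges G. edge_seg a \<subseteq> f ` edge_seg e} = {e \<in> edges G. a \<in> walk_edges (q e)}"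
    if "a \<in> edges H" for a
  proof -
    from H that have "card a = 2" by (simp add: graph_def)
    then show ?thesis by (simp add: f_seg edge_seg_subset_walk_seg_iff cong: conj_cong)
  qed
  ultimately have "coarse_wiring k G H f"
    using dw by (simp add: coarse_wiring_def f_vert discrete_wiring_def)
  moreover have "verts (wiring_image G H f) \<subseteq> discrete_image G g q"
    by (auto simp: wiring_image_def discrete_image_def f_vert f_seg vertex_point_in_walk_seg_iff)
  ultimately show thesis by (rule that)
qed

lemma finite_discrete_image:
  "graph G \<Longrightarrow> finite (verts G) \<Longrightarrow> finite (discrete_image G g q)"
  by (simp add: discrete_image_def graph_finite_edges)

lemma wir_le_card_discrete_image:
  assumes "graph G" "finite (verts G)" "graph H" "discrete_wiring k G H g q"
  shows "wir k G H \<le> enat (card (discrete_image G g q))"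
proof -
  obtain f where f: "coarse_wiring k G H f" "verts (wiring_image G H f) \<subseteq> discrete_image G g q"
    using discrete_wiring_realisable assms by blast
  have "wir k G H \<le> enat (volume G H f)"
    unfolding wir_def by (rule INF_lower) (use f in simp)
  also have "\<dots> \<le> enat (card (discrete_image G g q))"
    using f assms by (simp add: volume_def card_mono finite_discrete_image)
  finally show ?thesis .
qed

section \<open>From continuous wirings to discrete ones\<close>

text \<open>The walk that covers the image of an edge passes through the images of both ends but
  need not begin or end there. It is cut down to a piece between these two vertices; this only
  removes vertices and edges, so neither the multiplicities nor the image can grow.\<close>

lemma coarse_wiring_discretisable:
  assumes G: "graph G" and fin: "finite (verts G)" and H: "graph H" and f: "coarse_wiring k G H f"
  obtains g q where "discrete_wiring k G H g q" "card (discrete_image G g q) \<le> volume G H f"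
proof -
  have "\<forall>v\<in>verts G. \<exists>w\<in>verts H. f (vertex_point v) = vertex_point w"
    using f by (auto simp: coarse_wiring_def wiring_def)
  then obtain g where g: "\<And>v. v \<in> verts G \<Longrightarrow> g v \<in> verts H"
      "\<And>v. v \<in> verts G \<Longrightarrow> f (vertex_point v) = vertex_point (g v)"
    by metis
  have "\<forall>e\<in>edges G. \<exists>p. walk H p \<and> f ` edge_seg e = walk_seg p"
    using f by (auto simp: coarse_wiring_def wiring_def)
  then obtain p where p: "\<And>e. e \<in> edges G \<Longrightarrow> walk H (p e)"
      "\<And>e. e \<in> edges G \<Longrightarrow> f ` edge_seg e = walk_seg (p e)"
    by metis
  have "\<exists>q. q \<noteq> [] \<and> set q \<subseteq> set (p e) \<and> walk_edges q \<subseteq> walk_edges (p e) \<and>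
      (\<exists>u v. e = {u, v} \<and> hd q = g u \<and> last q = g v)" if e: "e \<in> edges G" for e
  proof -
    obtain u v where uv: "e = {u, v}" "u \<in> verts G" "v \<in> verts G"
      using G e by (rule graph_edgeE)
    have "vertex_point (g x) \<in> walk_seg (p e)" if "x \<in> {u, v}" for x
    proof -
      have "f (vertex_point x) \<in> f ` edge_seg e"
        using vertex_point_in_edge_seg[OF that] uv by blast
      then show ?thesis using that uv g p(2)[OF e] by auto
    qed
    then have "g u \<in> set (p e)" "g v \<in> set (p e)" by (simp_all add: vertex_point_in_walk_seg_iff)
    then obtain i j where ij: "i < length (p e)" "p e ! i = g u" "j < length (p e)" "p e ! j = g v"
      by (auto simp: in_set_conv_nth)
    \<comment> \<open>The images of the two ends may occur along the walk in either order; if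
      \<open>g v\<close> comes first, the edge is read as \<open>{v, u}\<close>.\<close>
    show ?thesis
    proof (cases "i \<le> j")
      case True
      then obtain q where "q \<noteq> []" "hd q = g u" "last q = g v" "set q \<subseteq> set (p e)"
          "walk_edges q \<subseteq> walk_edges (p e)"
        using subwalk[OF _ ij(3), of i] ij(2,4) by metis
      then show ?thesis using uv(1) by blast
    next
      case False
      then have "j \<le> i" by simp
      then obtain q where "q \<noteq> []" "hd q = g v" "last q = g u" "set q \<subseteq> set (p e)"
          "walk_edges q \<subseteq> walk_edges (p e)"
        using subwalk[OF _ ij(1), of j] ij(2,4) by metis
      moreover have "e = {v, u}" using uv(1) by blast
      ultimately show ?thesis by blast
    qed
  qed
  then obtain q where q: "\<And>e. e \<in> edges G \<Longrightarrow> q e \<noteq> []" "\<And>e. e \<in> edges G \<Longrightarrow> set (q e) \<subseteq> set (p e)"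
     "\<And>e. e \<in> edges G \<Longrightarrow> walk_edges (q e) \<subseteq> walk_edges (p e)"
     "\<And>e. e \<in> edges G \<Longrightarrow> \<exists>u v. e = {u, v} \<and> hd (q e) = g u \<and> last (q e) = g v"
    by metis
  have walk_q: "walk H (q e)" if "e \<in> edges G" for e
    using p(1)[OF that] q(1-3)[OF that] by (auto simp: walk_iff)
  have "discrete_wiring k G H g q"
    unfolding discrete_wiring_def
  proof (intro conjI ballI)
    fix w assume "w \<in> verts H"
    moreover have "{v \<in> verts G. g v = w} = {v \<in> verts G. f (vertex_point v) = vertex_point w}"
      using g by auto
    ultimately show "finite {v \<in> verts G. g v = w}" "card {v \<in> verts G. g v = w} \<le> k"
      using f by (auto simp: coarse_wiring_def)
  next
    fix a assume a: "a \<in> edges H"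
    let ?A = "{e \<in> edges G. edge_seg a \<subseteq> f ` edge_seg e}"
    have sub: "{e \<in> edges G. a \<in> walk_edges (q e)} \<subseteq> ?A"
    proof
      fix e assume "e \<in> {e \<in> edges G. a \<in> walk_edges (q e)}"
      then have e: "e \<in> edges G" "a \<in> walk_edges (p e)" using q(3) by auto
      from e(2) have "edge_seg a \<subseteq> walk_seg (p e)" by (auto simp: walk_seg_def)
      with e p(2) show "e \<in> ?A" by simp
    qed
    have A: "finite ?A" "card ?A \<le> k" using f a by (auto simp: coarse_wiring_def)
    show "finite {e \<in> edges G. a \<in> walk_edges (q e)}" using A(1) by (rule finite_subset[OF sub])
    show "card {e \<in> edges G. a \<in> walk_edges (q e)} \<le> k"
      using card_mono[OF A(1) sub] A(2) by simp
  qed (use g walk_q q(4) in auto)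
  moreover have "card (discrete_image G g q) \<le> volume G H f"
    unfolding volume_def
  proof (rule card_mono)
    \<comment> \<open>Finiteness matters because the volume is a \<open>card\<close>, which would be
      0 for an infinite set.\<close>
    have "verts (wiring_image G H f) \<subseteq> g ` verts G \<union> (\<Union>e\<in>edges G. set (p e))"
      by (auto simp: wiring_image_def g p vertex_point_in_walk_seg_iff)
    then show "finite (verts (wiring_image G H f))"
      by (rule finite_subset) (simp add: fin graph_finite_edges G)
    show "discrete_image G g q \<subseteq> verts (wiring_image G H f)"
    proof
      fix w assume "w \<in> discrete_image G g q"
      then consider v where "v \<in> verts G" "w = g v" | e where "e \<in> edges G" "w \<in> set (q e)"
        by (auto simp: discrete_image_def)
      then show "w \<in> verts (wiring_image G H f)"
      proof cases
        case (1 v)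
        with g show ?thesis by (auto simp: wiring_image_def)
      next
        case (2 e)
        then have "w \<in> verts H" using walk_q by (auto simp: walk_def)
        moreover have "vertex_point w \<in> f ` edge_seg e"
          using 2 q(2) p(2) by (auto simp: vertex_point_in_walk_seg_iff)
        ultimately show ?thesis using 2 by (auto simp: wiring_image_def)
      qed
    qed
  qed
  ultimately show thesis by (rule that)
qed

text \<open>The infimum of a nonempty set in \<open>enat\<close> is attained, so a finite
  \<open>wir\<close> is the volume of some coarse wiring, which is then made discrete.\<close>

lemma wir_finite_discrete:
  assumes "graph G" "finite (verts G)" "graph H" "wir k G H \<noteq> \<infinity>"
  obtains g q where "discrete_wiring k G H g q" "enat (card (discrete_image G g q)) \<le> wir k G H"
proof -
  let ?S = "(\<lambda>f. enat (volume G H f)) ` {f. coarse_wiring k G H f}"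
  have "?S \<noteq> {}" using assms(4) unfolding wir_def Inf_enat_def by metis
  then have "Inf ?S \<in> ?S" unfolding Inf_enat_def by (metis LeastI all_not_in_conv)
  then obtain f where f: "coarse_wiring k G H f" "wir k G H = enat (volume G H f)"
    by (auto simp: wir_def)
  from coarse_wiring_discretisable[OF assms(1-3) f(1)] that f(2) show thesis
    by (metis enat_ord_simps(1))
qed

section \<open>Composition of discrete wirings\<close>

text \<open>For counting in two stages: at most \<open>m\<close> intermediate objects, each reached
  from at most \<open>k\<close> others.\<close>

lemma card_UN_le_mult:
  assumes "finite I" "card I \<le> m" "\<And>i. i \<in> I \<Longrightarrow> finite (A i) \<and> card (A i) \<le> k"
  shows "finite (\<Union>i\<in>I. A i)" "card (\<Union>i\<in>I. A i) \<le> m * k"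
proof -
  show "finite (\<Union>i\<in>I. A i)" using assms by auto
  have "card (\<Union>i\<in>I. A i) \<le> (\<Sum>i\<in>I. card (A i))" by (rule card_UN_le[OF assms(1)])
  also have "\<dots> \<le> card I * k" using sum_bounded_above[of I "\<lambda>i. card (A i)" k] assms by simp
  also have "\<dots> \<le> m * k" using assms by simp
  finally show "card (\<Union>i\<in>I. A i) \<le> m * k" .
qed

text \<open>Each edge of \<open>p\<close> is replaced by the walk assigned to it, and these walks
  are joined at the images of the vertices of \<open>p\<close>.\<close>

lemma discrete_wiring_push_walk:
  assumes dw: "discrete_wiring k H K g q" and p: "walk H p"
  obtains p' where "walk K p'" "hd p' = g (hd p)" "last p' = g (last p)"
    "set p' \<subseteq> g ` set p \<union> (\<Union>a\<in>walk_edges p. set (q a))"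
    "walk_edges p' \<subseteq> (\<Union>a\<in>walk_edges p. walk_edges (q a))"
proof -
  have "\<exists>p'. walk K p' \<and> hd p' = g (hd p) \<and> last p' = g (last p) \<and>
    set p' \<subseteq> g ` set p \<union> (\<Union>a\<in>walk_edges p. set (q a)) \<and>
    walk_edges p' \<subseteq> (\<Union>a\<in>walk_edges p. walk_edges (q a))"
    using p
  proof (induction p rule: induct_list012)
    case (2 x)
    then have "walk K [g x]" using discrete_wiring_vertD[OF dw] by (auto simp: walk_iff)
    then show ?case by (intro exI[of _ "[g x]"]) auto
  next
    case (3 x y p)
    then have xy: "{x, y} \<in> edges H" and "walk H (y # p)" by (auto simp: walk_iff)
    with 3 obtain p' where p': "walk K p'" "hd p' = g y" "last p' = g (last (y # p))"
        "set p' \<subseteq> g ` set (y # p) \<union> (\<Union>a\<in>walk_edges (y # p). set (q a))"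
        "walk_edges p' \<subseteq> (\<Union>a\<in>walk_edges (y # p). walk_edges (q a))"
      by auto
    \<comment> \<open>The walk assigned to \<open>{x, y}\<close> may run from \<open>g y\<close> to
      \<open>g x\<close>; it is then reversed, which leaves its vertices and edges the same.\<close>
    obtain r where r: "walk K r" "hd r = g x" "last r = g y" "set r = set (q {x, y})"
        "walk_edges r = walk_edges (q {x, y})"
    proof -
      note w = discrete_wiring_walkD[OF dw xy]
      then have ne: "q {x, y} \<noteq> []" by (simp add: walk_def)
      obtain u v where uv: "{x, y} = {u, v}" "hd (q {x, y}) = g u" "last (q {x, y}) = g v"
        using dw xy by (rule discrete_wiring_endsE)
      then consider "u = x" "v = y" | "u = y" "v = x" by (auto simp: doubleton_eq_iff)
      then show thesis
      proof cases
        case 1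
        with uv w that show thesis by blast
      next
        case 2
        with uv w ne that[of "rev (q {x, y})"] show thesis
          by (simp add: walk_rev hd_rev last_rev walk_edges_rev)
      qed
    qed
    have ne: "r \<noteq> []" "p' \<noteq> []" using r p' by (auto simp: walk_def)
    have eq: "last r = hd p'" using r p' by simp
    let ?s = "r @ tl p'"
    have es: "walk_edges ?s = walk_edges r \<union> walk_edges p'" using ne eq by (rule walk_edges_join)
    have ss: "set ?s \<subseteq> set r \<union> set p'" by (cases p') auto
    have "walk K ?s" using es ss r(1) p'(1) ne unfolding walk_iff by blast
    moreover have "hd ?s = g x" using ne r by simp
    moreover have "last ?s = g (last (y # p))"
    proof -
      obtain s where s: "p' = last r # s" using ne(2) eq by (cases p') auto
      show ?thesis using p'(3) ne(1) unfolding s by (simp add: last_append split: if_splits)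
    qed
    moreover have "set ?s \<subseteq> g ` set (x # y # p) \<union> (\<Union>a\<in>walk_edges (x # y # p). set (q a))"
      using ss r p' by auto
    moreover have "walk_edges ?s \<subseteq> (\<Union>a\<in>walk_edges (x # y # p). walk_edges (q a))"
      using es r p' by auto
    ultimately show ?case by (intro exI[of _ ?s]) simp
  qed (simp add: walk_iff)
  then show thesis by (elim exE conjE) (rule that)
qed

text \<open>If the new walk of \<open>e\<close> uses an edge \<open>b\<close> of \<open>K\<close>,
  then \<open>b\<close> lies on \<open>q2 a\<close> for some edge \<open>a\<close> on
  \<open>q1 e\<close>: there are at most \<open>m\<close> such \<open>a\<close>, and at most
  \<open>k\<close> edges \<open>e\<close> for each. Vertices are counted in the same way. The second
  conclusion keeps the walks \<open>q2 a\<close> visible, so that their vertices can later be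
  counted edge by edge.\<close>

lemma discrete_wiring_compose:
  assumes dw1: "discrete_wiring k G H g1 q1" and dw2: "discrete_wiring m H K g2 q2"
  obtains q where "discrete_wiring (m * k) G K (g2 \<circ> g1) q"
    "discrete_image G (g2 \<circ> g1) q \<subseteq>
       g2 ` discrete_image G g1 q1 \<union> (\<Union>e\<in>edges G. \<Union>a\<in>walk_edges (q1 e). set (q2 a))"
proof -
  have "\<exists>p'. walk K p' \<and> hd p' = g2 (hd (q1 e)) \<and> last p' = g2 (last (q1 e)) \<and>
    set p' \<subseteq> g2 ` set (q1 e) \<union> (\<Union>a\<in>walk_edges (q1 e). set (q2 a)) \<and>
    walk_edges p' \<subseteq> (\<Union>a\<in>walk_edges (q1 e). walk_edges (q2 a))" if "e \<in> edges G" for e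
    using discrete_wiring_push_walk[OF dw2 discrete_wiring_walkD[OF dw1 that]] by metis
  then obtain q where q: "\<And>e. e \<in> edges G \<Longrightarrow> walk K (q e)"
    "\<And>e. e \<in> edges G \<Longrightarrow> hd (q e) = g2 (hd (q1 e))"
    "\<And>e. e \<in> edges G \<Longrightarrow> last (q e) = g2 (last (q1 e))"
    "\<And>e. e \<in> edges G \<Longrightarrow> set (q e) \<subseteq> g2 ` set (q1 e) \<union> (\<Union>a\<in>walk_edges (q1 e). set (q2 a))"
    "\<And>e. e \<in> edges G \<Longrightarrow> walk_edges (q e) \<subseteq> (\<Union>a\<in>walk_edges (q1 e). walk_edges (q2 a))"
    by metis
  have "discrete_wiring (m * k) G K (g2 \<circ> g1) q"
    unfolding discrete_wiring_def
  proof (intro conjI ballI)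
    show "(g2 \<circ> g1) ` verts G \<subseteq> verts K"
      using discrete_wiring_vertD[OF dw1] discrete_wiring_vertD[OF dw2] by auto
    fix e assume e: "e \<in> edges G"
    show "walk K (q e)" using q e by blast
    show "\<exists>u v. e = {u, v} \<and> hd (q e) = (g2 \<circ> g1) u \<and> last (q e) = (g2 \<circ> g1) v"
      using discrete_wiring_endsE[OF dw1 e] q(2,3)[OF e] by (metis comp_apply)
  next
    fix w assume "w \<in> verts K"
    note 2 = discrete_wiring_vert_card[OF dw2 this]
    let ?U = "\<Union>u\<in>{u \<in> verts H. g2 u = w}. {v \<in> verts G. g1 v = u}"
    have U: "finite ?U" "card ?U \<le> m * k"
      using card_UN_le_mult[of "{u \<in> verts H. g2 u = w}" m "\<lambda>u. {v \<in> verts G. g1 v = u}" k]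
        2 discrete_wiring_vert_card[OF dw1] by auto
    have sub: "{v \<in> verts G. (g2 \<circ> g1) v = w} \<subseteq> ?U"
      using discrete_wiring_vertD[OF dw1] by auto
    show "finite {v \<in> verts G. (g2 \<circ> g1) v = w}" using U(1) by (rule finite_subset[OF sub])
    show "card {v \<in> verts G. (g2 \<circ> g1) v = w} \<le> m * k"
      using card_mono[OF U(1) sub] U(2) by simp
  next
    fix b assume "b \<in> edges K"
    note 2 = discrete_wiring_edge_card[OF dw2 this]
    let ?U = "\<Union>a\<in>{a \<in> edges H. b \<in> walk_edges (q2 a)}. {e \<in> edges G. a \<in> walk_edges (q1 e)}"
    have U: "finite ?U" "card ?U \<le> m * k"
      using card_UN_le_mult[of "{a \<in> edges H. b \<in> walk_edges (q2 a)}" m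
          "\<lambda>a. {e \<in> edges G. a \<in> walk_edges (q1 e)}" k]
        2 discrete_wiring_edge_card[OF dw1] by auto
    have sub: "{e \<in> edges G. b \<in> walk_edges (q e)} \<subseteq> ?U"
    proof
      fix e assume e: "e \<in> {e \<in> edges G. b \<in> walk_edges (q e)}"
      then obtain a where "a \<in> walk_edges (q1 e)" "b \<in> walk_edges (q2 a)" using q(5) by blast
      moreover from this have "a \<in> edges H"
        using discrete_wiring_walkD[OF dw1] e by (auto simp: walk_iff)
      ultimately show "e \<in> ?U" using e by blast
    qed
    show "finite {e \<in> edges G. b \<in> walk_edges (q e)}" using U(1) by (rule finite_subset[OF sub])
    show "card {e \<in> edges G. b \<in> walk_edges (q e)} \<le> m * k"
      using card_mono[OF U(1) sub] U(2) by simp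
  qed
  moreover have "discrete_image G (g2 \<circ> g1) q \<subseteq>
       g2 ` discrete_image G g1 q1 \<union> (\<Union>e\<in>edges G. \<Union>a\<in>walk_edges (q1 e). set (q2 a))"
    using q(4) unfolding discrete_image_def by fastforce
  ultimately show thesis by (rule that)
qed

section \<open>Regular maps of graphs with bounded degree\<close>

text \<open>Lengths of walks are integers, so a walk shorter than
  \<open>\<lfloor>t\<rfloor> + 1\<close> has length at most \<open>t\<close>. The \<open>+ 1\<close>
  in the conclusion arises because \<open>length p\<close> counts vertices, not edges.\<close>

lemma gdist_le_walkE:
  assumes "gdist G u v \<le> ereal t"
  obtains p where "walk G p" "hd p = u" "last p = v" "real (length p) \<le> t + 1"
proof -
  have "gdist G u v < ereal (real_of_int \<lfloor>t\<rfloor> + 1)"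
    using assms by (rule le_less_trans) simp
  then obtain p where p: "walk G p" "hd p = u" "last p = v"
      and "real (length p - 1) < real_of_int \<lfloor>t\<rfloor> + 1"
    by (auto simp: gdist_def INF_less_iff)
  then have "int (length p - 1) \<le> \<lfloor>t\<rfloor>" by linarith
  then have "real (length p - 1) \<le> t" by linarith
  moreover have "length p \<ge> 1" using p(1) by (cases p) (auto simp: walk_def)
  ultimately show thesis using that[OF p] by (simp add: of_nat_diff)
qed

lemma gdist_le_of_walk:
  assumes "walk G p" "hd p = u" "last p = v" "length p \<le> Suc n"
  shows "gdist G u v \<le> ereal (real n)"
proof -
  have "gdist G u v \<le> ereal (real (length p - 1))"
    unfolding gdist_def by (rule INF_lower) (use assms in simp)
  also have "\<dots> \<le> ereal (real n)" using assms(4) by simp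
  finally show ?thesis .
qed

lemma neighbours_card:
  assumes "max_degree_le G d" "v \<in> verts G"
  shows "finite (insert v {w. {v, w} \<in> edges G}) \<and> card (insert v {w. {v, w} \<in> edges G}) \<le> Suc d"
proof -
  let ?N = "{w. {v, w} \<in> edges G}" and ?E = "{e \<in> edges G. v \<in> e}"
  have E: "finite ?E" "card ?E \<le> d" using assms by (auto simp: max_degree_le_def)
  have inj: "inj_on (\<lambda>w. {v, w}) ?N" by (auto simp: inj_on_def doubleton_eq_iff)
  have sub: "(\<lambda>w. {v, w}) ` ?N \<subseteq> ?E" by auto
  have "finite ?N" using inj sub E(1) by (rule inj_on_finite)
  moreover have "card ?N \<le> d" using card_inj_on_le[OF inj sub E(1)] E(2) by simp
  ultimately show ?thesis by (simp add: card_insert_if)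
qed

text \<open>A walk with at most two vertices is a single vertex or a single edge.\<close>

lemma closed_ball_gdist_1: "closed_ball (verts G) (gdist G) c 1 \<subseteq> insert c {y. {c, y} \<in> edges G}"
proof
  fix y assume "y \<in> closed_ball (verts G) (gdist G) c 1"
  then have "gdist G c y \<le> ereal 1" by (simp add: closed_ball_def one_ereal_def)
  then obtain p where p: "walk G p" "hd p = c" "last p = y" "real (length p) \<le> 1 + 1"
    by (rule gdist_le_walkE)
  show "y \<in> insert c {y. {c, y} \<in> edges G}"
  proof (cases p)
    case Nil
    with p show ?thesis by (simp add: walk_def)
  next
    case (Cons a r)
    with p show ?thesis by (cases r) (auto simp: walk_iff)
  qed
qed

text \<open>\<open>B n\<close> consists of the vertices that reach \<open>w\<close> in at most
  \<open>n\<close> steps. Removing the first vertex of a walk shows that \<open>B (Suc n)\<close> is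
  covered by the closed neighbourhoods of the points of \<open>B n\<close>, each of size at most
  \<open>Suc d\<close>.\<close>

lemma walks_to_card:
  assumes deg: "max_degree_le G d" and w: "w \<in> verts G"
  defines "B \<equiv> \<lambda>n. {y. \<exists>p. walk G p \<and> hd p = y \<and> last p = w \<and> length p \<le> Suc n}"
  shows "finite (B n) \<and> card (B n) \<le> Suc d ^ n"
proof (induction n)
  case 0
  have "B 0 \<subseteq> {w}"
  proof
    fix y assume "y \<in> B 0"
    then obtain p where p: "walk G p" "hd p = y" "last p = w" "length p \<le> Suc 0"
      unfolding B_def by blast
    then show "y \<in> {w}" by (cases p) (simp_all add: walk_def)
  qed
  from finite_subset[OF this] card_mono[OF _ this] show ?case by simp
next
  case (Suc n)
  let ?N = "\<lambda>z. insert z {y. {z, y} \<in> edges G}"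
  have "y \<in> verts G" if "y \<in> B n" for y
    using that unfolding B_def by (auto dest: walk_hd_in_verts)
  then have N: "finite (?N z) \<and> card (?N z) \<le> Suc d" if "z \<in> B n" for z
    using neighbours_card[OF deg] that by simp
  from Suc have B: "finite (B n)" "card (B n) \<le> Suc d ^ n" by auto
  have U: "finite (\<Union>z\<in>B n. ?N z)" "card (\<Union>z\<in>B n. ?N z) \<le> Suc d ^ n * Suc d"
    by (rule card_UN_le_mult[OF B N], assumption)+
  have sub: "B (Suc n) \<subseteq> (\<Union>z\<in>B n. ?N z)"
  proof
    fix y assume "y \<in> B (Suc n)"
    then obtain p where p: "walk G p" "hd p = y" "last p = w" "length p \<le> Suc (Suc n)"
      unfolding B_def by blast
    then obtain r where r: "p = y # r" by (cases p) (auto simp: walk_def)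
    show "y \<in> (\<Union>z\<in>B n. ?N z)"
    proof (cases r)
      case Nil
      with p r have "walk G [w]" "y = w" by auto
      then have "w \<in> B n" unfolding B_def mem_Collect_eq by (intro exI[of _ "[w]"]) simp
      with \<open>y = w\<close> show ?thesis by blast
    next
      case (Cons z s)
      with p r have "walk G r" "last r = w" "length r \<le> Suc n" "{z, y} \<in> edges G"
        by (auto simp: walk_iff insert_commute)
      moreover from this Cons have "z \<in> B n"
        unfolding B_def mem_Collect_eq by (intro exI[of _ r]) simp
      ultimately show ?thesis by blast
    qed
  qed
  show ?case
    using finite_subset[OF sub U(1)] card_mono[OF U(1) sub] U(2) unfolding power_Suc2 by linarith
qed

section \<open>Regular maps as discrete wirings\<close>

lemma regular_map_into: "regular_map \<kappa> A dA B dB r \<Longrightarrow> x \<in> A \<Longrightarrow> r x \<in> B"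
  by (simp add: regular_map_def image_subset_iff)

lemma regular_map_dist:
  "regular_map \<kappa> A dA B dB r \<Longrightarrow> x \<in> A \<Longrightarrow> x' \<in> A \<Longrightarrow>
   dB (r x) (r x') \<le> ereal \<kappa> * (1 + dA x x')"
  by (simp add: regular_map_def)

text \<open>The fibre over \<open>w\<close> lies in the preimage of the unit ball around
  \<open>w\<close>, and each covering unit ball lies in a closed neighbourhood of its
  centre.\<close>

lemma regular_map_fibre_cover:
  assumes "regular_map \<kappa> (verts A) (gdist A) (verts B) (gdist B) r" "w \<in> verts B"
  obtains C where "C \<subseteq> verts A" "finite C" "real (card C) \<le> \<kappa>"
    "{x \<in> verts A. r x = w} \<subseteq> (\<Union>c\<in>C. insert c {y. {c, y} \<in> edges A})"
proof -
  obtain C where C: "C \<subseteq> verts A" "finite C" "real (card C) \<le> \<kappa>"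
    "{x \<in> verts A. r x \<in> closed_ball (verts B) (gdist B) w 1}
       \<subseteq> (\<Union>c\<in>C. closed_ball (verts A) (gdist A) c 1)"
    using assms unfolding regular_map_def by meson
  have "gdist B w w \<le> ereal (real 1)"
    by (rule gdist_le_of_walk[of _ "[w]"]) (use assms(2) in \<open>auto simp: walk_iff\<close>)
  then have "w \<in> closed_ball (verts B) (gdist B) w 1"
    using assms(2) by (simp add: closed_ball_def one_ereal_def)
  then have "{x \<in> verts A. r x = w} \<subseteq> (\<Union>c\<in>C. closed_ball (verts A) (gdist A) c 1)"
    using C(4) by blast
  also have "\<dots> \<subseteq> (\<Union>c\<in>C. insert c {y. {c, y} \<in> edges A})"
    using closed_ball_gdist_1 by fast
  finally show thesis using that C by blast
qed

text \<open>The fibre over \<open>r x\<close> contains \<open>x\<close>, so its cover has at least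
  one centre.\<close>

lemma regular_map_ge_1:
  assumes "regular_map \<kappa> (verts A) (gdist A) (verts B) (gdist B) r" "x \<in> verts A"
  shows "\<kappa> \<ge> 1"
proof -
  have "r x \<in> verts B" using assms by (rule regular_map_into)
  then obtain C where C: "finite C" "real (card C) \<le> \<kappa>"
    "{x' \<in> verts A. r x' = r x} \<subseteq> (\<Union>c\<in>C. insert c {y. {c, y} \<in> edges A})"
    by (rule regular_map_fibre_cover[OF assms(1)])
  have "C \<noteq> {}"
  proof
    assume "C = {}"
    with C(3) have "{x' \<in> verts A. r x' = r x} = {}" by simp
    with assms(2) show False by blast
  qed
  then have "card C \<ge> 1" using C(1) by (simp add: Suc_leI card_gt_0_iff)
  with C(2) show ?thesis by linarith
qed

text \<open>The ends of an edge are at distance at most 1, so their images are at distance at most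
  \<open>2 * \<kappa>\<close> and a joining walk has at most \<open>2 * \<kappa> + 1\<close>
  vertices. If that walk uses an edge \<open>b\<close>, it starts at the image of an end of
  \<open>e\<close> and near \<open>b\<close>; bounded degree and bounded fibres leave finitely many
  choices for \<open>e\<close>, with a uniform bound.\<close>

lemma regular_map_discrete_wiring:
  assumes A: "graph A" "max_degree_le A d" and B: "graph B" "max_degree_le B d"
    and \<kappa>: "\<kappa> > 0" and r: "regular_map \<kappa> (verts A) (gdist A) (verts B) (gdist B) r"
  obtains m q where "discrete_wiring m A B r q"
    "\<And>e. e \<in> edges A \<Longrightarrow> real (length (q e)) \<le> 2 * \<kappa> + 1"
proof -
  have rB: "r x \<in> verts B" if "x \<in> verts A" for x
    using r that by (rule regular_map_into)
  have "\<exists>p. walk B p \<and> (\<exists>u v. e = {u, v} \<and> hd p = r u \<and> last p = r v) \<and>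
      real (length p) \<le> 2 * \<kappa> + 1" if e: "e \<in> edges A" for e
  proof -
    obtain u v where uv: "e = {u, v}" "u \<in> verts A" "v \<in> verts A"
      using A(1) e by (rule graph_edgeE)
    have "gdist A u v \<le> ereal (real 1)"
      by (rule gdist_le_of_walk[of _ "[u, v]"]) (use uv e in \<open>auto simp: walk_iff\<close>)
    then have "1 + gdist A u v \<le> 1 + 1" by (intro add_left_mono) (simp add: one_ereal_def)
    then have "ereal \<kappa> * (1 + gdist A u v) \<le> ereal \<kappa> * (1 + 1)"
      using \<kappa> by (intro ereal_mult_left_mono) auto
    moreover have "gdist B (r u) (r v) \<le> ereal \<kappa> * (1 + gdist A u v)"
      using r uv(2,3) by (rule regular_map_dist)
    ultimately have "gdist B (r u) (r v) \<le> ereal (2 * \<kappa>)"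
      by (simp add: one_ereal_def mult.commute)
    then show ?thesis using uv(1) by (metis gdist_le_walkE)
  qed
  then obtain q where q: "\<And>e. e \<in> edges A \<Longrightarrow> walk B (q e)"
    "\<And>e. e \<in> edges A \<Longrightarrow> \<exists>u v. e = {u, v} \<and> hd (q e) = r u \<and> last (q e) = r v"
    "\<And>e. e \<in> edges A \<Longrightarrow> real (length (q e)) \<le> 2 * \<kappa> + 1"
    by metis
  \<comment> \<open>\<open>M\<close> bounds the fibres: at most
    \<open>\<lfloor>\<kappa>\<rfloor>\<close> centres, each with a closed neighbourhood of at most
    \<open>Suc d\<close> vertices. \<open>D\<close> bounds the number of edges of a walk
    \<open>q e\<close>. In \<open>m\<close>, the product counts starting points near an end of
    \<open>b\<close>, their preimages, and the edges at each preimage.\<close>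
  define M where "M = nat \<lfloor>\<kappa>\<rfloor> * Suc d"
  define D where "D = nat \<lfloor>2 * \<kappa>\<rfloor>"
  define m where "m = max M (Suc d ^ D * M * d)"
  have fibre: "finite {x \<in> verts A. r x = w} \<and> card {x \<in> verts A. r x = w} \<le> M"
    if w: "w \<in> verts B" for w
  proof -
    let ?N = "\<lambda>c. insert c {y. {c, y} \<in> edges A}"
    obtain C where C: "C \<subseteq> verts A" "finite C" "real (card C) \<le> \<kappa>"
      and sub: "{x \<in> verts A. r x = w} \<subseteq> (\<Union>c\<in>C. ?N c)"
      by (rule regular_map_fibre_cover[OF r w])
    have C': "card C \<le> nat \<lfloor>\<kappa>\<rfloor>" using C(3) by (rule le_nat_floor)
    have "finite (?N c) \<and> card (?N c) \<le> Suc d" if "c \<in> C" for c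
      by (rule neighbours_card[OF A(2) subsetD[OF C(1) that]])
    note N = this
    have U: "finite (\<Union>c\<in>C. ?N c)" "card (\<Union>c\<in>C. ?N c) \<le> M"
      unfolding M_def by (rule card_UN_le_mult[OF C(2) C' N], assumption)+
    show ?thesis using finite_subset[OF sub U(1)] card_mono[OF U(1) sub] U(2) by simp
  qed
  have "discrete_wiring m A B r q"
    unfolding discrete_wiring_def
  proof (intro conjI ballI)
    fix w assume "w \<in> verts B"
    from fibre[OF this]
    show "finite {x \<in> verts A. r x = w}" "card {x \<in> verts A. r x = w} \<le> m"
      by (auto simp: m_def)
  next
    fix b assume "b \<in> edges B"
    then obtain w where w: "w \<in> b" "w \<in> verts B" using B(1) by (blast elim: graph_edgeE)
    let ?B = "{y. \<exists>p. walk B p \<and> hd p = y \<and> last p = w \<and> length p \<le> Suc D}"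
    let ?S = "\<Union>z\<in>?B. {x \<in> verts A. r x = z}"
    let ?U = "\<Union>x\<in>?S. {e \<in> edges A. x \<in> e}"
    note near = walks_to_card[OF B(2) w(2), of D]
    have "y \<in> verts B" if "y \<in> ?B" for y using that by (auto dest: walk_hd_in_verts)
    then have F: "finite {x \<in> verts A. r x = z} \<and> card {x \<in> verts A. r x = z} \<le> M" if "z \<in> ?B" for z
      using fibre that by simp
    have S: "finite ?S" "card ?S \<le> Suc d ^ D * M"
      by (rule card_UN_le_mult[OF conjunct1[OF near] conjunct2[OF near] F], assumption)+
    have deg: "finite {e \<in> edges A. x \<in> e} \<and> card {e \<in> edges A. x \<in> e} \<le> d" if "x \<in> ?S" for x
    proof -
      have "x \<in> verts A" using that by blast
      with A(2) show ?thesis by (simp add: max_degree_le_def)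
    qed
    have U: "finite ?U" "card ?U \<le> Suc d ^ D * M * d"
      by (rule card_UN_le_mult[OF S deg], assumption)+
    then have U: "finite ?U" "card ?U \<le> m" by (simp_all add: m_def)
    have sub: "{e \<in> edges A. b \<in> walk_edges (q e)} \<subseteq> ?U"
    proof
      fix e assume "e \<in> {e \<in> edges A. b \<in> walk_edges (q e)}"
      then have e: "e \<in> edges A" "b \<in> walk_edges (q e)" by auto
      obtain u v where uv: "e = {u, v}" "hd (q e) = r u" using q(2)[OF e(1)] by blast
      have "w \<in> set (q e)" using walk_edges_subset_set[OF e(2)] w(1) by blast
      then obtain j where j: "j < length (q e)" "q e ! j = w" by (auto simp: in_set_conv_nth)
      \<comment> \<open>The initial piece of \<open>q e\<close> up to \<open>w\<close> has
        \<open>j\<close> edges, and \<open>j\<close> is less than the number of vertices of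
        \<open>q e\<close>, hence at most \<open>2 * \<kappa>\<close>.\<close>
      obtain p where p: "p \<noteq> []" "hd p = q e ! 0" "last p = w" "set p \<subseteq> set (q e)"
          "walk_edges p \<subseteq> walk_edges (q e)" "length p = Suc j"
        using subwalk[OF _ j(1), of 0] j(2) by auto
      have "walk B p" using p q(1)[OF e(1)] unfolding walk_iff by blast
      moreover have "hd p = r u" using p(2) uv(2) q(1)[OF e(1)] by (simp add: walk_def hd_conv_nth)
      moreover have "real j \<le> 2 * \<kappa>" using j(1) q(3)[OF e(1)] by linarith
      then have "length p \<le> Suc D" using p(6) le_nat_floor unfolding D_def by simp
      ultimately have "r u \<in> ?B" using p(3) by blast
      moreover have "u \<in> verts A" "u \<in> e" using A(1) e(1) uv(1) by (auto simp: graph_def)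
      ultimately show "e \<in> ?U" using e(1) by blast
    qed
    show "finite {e \<in> edges A. b \<in> walk_edges (q e)}" using U(1) by (rule finite_subset[OF sub])
    show "card {e \<in> edges A. b \<in> walk_edges (q e)} \<le> m"
      using card_mono[OF U(1) sub] U(2) by simp
  qed (use rB q in auto)
  with q(3) show thesis by (rule that[rotated])
qed

section \<open>The volume bound\<close>

text \<open>Incidences between \<open>S\<close> and the edges inside it are counted twice: each such
  edge has two ends in \<open>S\<close>, and each vertex meets at most \<open>d\<close>
  edges.\<close>

lemma induced_edges_card:
  assumes "graph G" "max_degree_le G d" "finite S" "S \<subseteq> verts G"
  shows "finite {a \<in> edges G. a \<subseteq> S}" "2 * card {a \<in> edges G. a \<subseteq> S} \<le> d * card S"
proof -
  let ?E = "{a \<in> edges G. a \<subseteq> S}"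
  show fin: "finite ?E" by (rule finite_subset[of _ "Pow S"]) (use assms in auto)
  have "card {v \<in> S. v \<in> a} = 2" if "a \<in> ?E" for a
  proof -
    have "{v \<in> S. v \<in> a} = a" using that by auto
    then show ?thesis using that assms(1) by (simp add: graph_def)
  qed
  then have "2 * card ?E = (\<Sum>v\<in>S. card {a \<in> ?E. v \<in> a})"
    using sum_multicount[OF assms(3) fin, of "\<lambda>v a. v \<in> a" 2] by simp
  also have "\<dots> \<le> (\<Sum>v\<in>S. d)"
  proof (rule sum_mono)
    fix v assume "v \<in> S"
    then have deg: "finite {e \<in> edges G. v \<in> e}" "card {e \<in> edges G. v \<in> e} \<le> d"
      using assms by (auto simp: max_degree_le_def)
    have "card {a \<in> ?E. v \<in> a} \<le> card {e \<in> edges G. v \<in> e}"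
      using deg(1) by (rule card_mono) auto
    with deg(2) show "card {a \<in> ?E. v \<in> a} \<le> d" by simp
  qed
  finally show "2 * card ?E \<le> d * card S" by (simp add: mult.commute)
qed

lemma set_subset_ends_interior:
  "p \<noteq> [] \<Longrightarrow> set p \<subseteq> {hd p, last p} \<union> set (butlast (tl p))"
proof (cases p)
  case (Cons x r)
  then show ?thesis by (cases r rule: rev_cases) auto
qed simp

text \<open>The ends of each walk are images of points of \<open>S\<close>, so an edge inside
  \<open>S\<close> adds only the interior vertices of its walk. Leaving \<open>T\<close> arbitrary
  serves both the image of a composite wiring and the image of a subgraph.\<close>

lemma expansion_card:
  assumes G: "graph G" "max_degree_le G d" and d: "d \<ge> 1" and \<kappa>: "\<kappa> \<ge> (1::real)"
    and dw: "discrete_wiring m G H g q"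
    and len: "\<And>e. e \<in> edges G \<Longrightarrow> real (length (q e)) \<le> 2 * \<kappa> + 1"
    and S: "finite S" "S \<subseteq> verts G"
    and T: "T \<subseteq> g ` S \<union> (\<Union>a\<in>{a \<in> edges G. a \<subseteq> S}. set (q a))"
  shows "real (card T) \<le> (\<kappa> + 1/2) * real d * real (card S)"
proof -
  let ?E = "{a \<in> edges G. a \<subseteq> S}"
  let ?I = "\<lambda>a. set (butlast (tl (q a)))"
  have E: "finite ?E" "2 * card ?E \<le> d * card S"
    using induced_edges_card[OF G S] by auto
  have sub: "T \<subseteq> g ` S \<union> (\<Union>a\<in>?E. ?I a)"
  proof -
    have "set (q a) \<subseteq> g ` S \<union> ?I a" if a: "a \<in> ?E" for a
    proof -
      have aE: "a \<in> edges G" using a by simp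
      obtain u v where uv: "a = {u, v}" "hd (q a) = g u" "last (q a) = g v"
        using dw aE by (rule discrete_wiring_endsE)
      then have "{hd (q a), last (q a)} \<subseteq> g ` S" using a by auto
      moreover have "q a \<noteq> []" using discrete_wiring_walkD[OF dw aE] by (simp add: walk_def)
      ultimately show ?thesis using set_subset_ends_interior[of "q a"] by blast
    qed
    with T show ?thesis by blast
  qed
  have I: "real (card (?I a)) \<le> 2 * \<kappa> - 1" if "a \<in> ?E" for a
  proof -
    \<comment> \<open>The subtraction is truncated when the walk is a single vertex; the bound
      \<open>2 * \<kappa> - 1\<close> still holds then, being positive for
      \<open>\<kappa> \<ge> 1\<close>.\<close>
    have "card (?I a) \<le> length (q a) - 2"
      using card_length[of "butlast (tl (q a))"] by simp
    with len[of a] that \<kappa> show ?thesis by (auto simp: of_nat_diff)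
  qed
  have "card T \<le> card (g ` S \<union> (\<Union>a\<in>?E. ?I a))"
    using sub S(1) E(1) by (intro card_mono) auto
  also have "\<dots> \<le> card (g ` S) + card (\<Union>a\<in>?E. ?I a)" by (rule card_Un_le)
  also have "\<dots> \<le> card S + (\<Sum>a\<in>?E. card (?I a))"
    by (rule add_mono[OF card_image_le[OF S(1)] card_UN_le[OF E(1)]])
  finally have "real (card T) \<le> real (card S + (\<Sum>a\<in>?E. card (?I a)))"
    by (simp only: of_nat_le_iff)
  also have "\<dots> = real (card S) + (\<Sum>a\<in>?E. real (card (?I a)))" by simp
  also have "(\<Sum>a\<in>?E. real (card (?I a))) \<le> real (card ?E) * (2 * \<kappa> - 1)"
    by (rule sum_bounded_above) (rule I)
  also have "real (card ?E) * (2 * \<kappa> - 1) \<le> real d * real (card S) / 2 * (2 * \<kappa> - 1)"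
  proof (rule mult_right_mono)
    have "2 * real (card ?E) \<le> real d * real (card S)"
      using E(2) by (metis of_nat_le_iff of_nat_mult of_nat_numeral)
    then show "real (card ?E) \<le> real d * real (card S) / 2" by simp
  qed (use \<kappa> in simp)
  \<comment> \<open>Written so that the term to be dropped is visibly nonnegative: this is where
    \<open>d \<ge> 1\<close> enters.\<close>
  also have "real (card S) + real d * real (card S) / 2 * (2 * \<kappa> - 1)
      = (\<kappa> + 1/2) * real d * real (card S) - (real d - 1) * real (card S)"
    by (simp add: field_simps)
  also have "\<dots> \<le> (\<kappa> + 1/2) * real d * real (card S)" using d by simp
  finally show ?thesis by simp
qed

lemma discrete_image_subset_verts:
  assumes "discrete_wiring k G H g q"
  shows "discrete_image G g q \<subseteq> verts H"
  using discrete_wiring_vertD[OF assms] discrete_wiring_walkD[OF assms]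
  by (auto simp: discrete_image_def walk_def)

text \<open>Every edge used by the wiring into \<open>Y\<close> has both ends in its image
  \<open>?S\<close>, so the expansion bound applies to \<open>?S\<close>. The slack in
  \<open>l\<close> and \<open>N\<close> allows one multiplicity for both inequalities and a profile
  value on the right.\<close>

lemma wir_push_le:
  assumes G: "graph G" "finite (verts G)" and Y: "graph Y" "max_degree_le Y d" and Y': "graph Y'"
    and d: "d \<ge> 1" and \<kappa>: "\<kappa> \<ge> (1::real)"
    and dw1: "discrete_wiring k G Y g q"
    and dw2: "discrete_wiring m Y Y' r p"
    and len: "\<And>e. e \<in> edges Y \<Longrightarrow> real (length (p e)) \<le> 2 * \<kappa> + 1"
    and l: "m * k \<le> l"
    and N: "enat (card (discrete_image G g q)) \<le> N"
  shows "ereal_of_enat (wir l G Y') \<le> ereal ((\<kappa> + 1/2) * real d) * ereal_of_enat N"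
proof -
  obtain q' where q': "discrete_wiring (m * k) G Y' (r \<circ> g) q'"
    "discrete_image G (r \<circ> g) q' \<subseteq>
       r ` discrete_image G g q \<union> (\<Union>e\<in>edges G. \<Union>a\<in>walk_edges (q e). set (p a))"
    using discrete_wiring_compose[OF dw1 dw2] by blast
  let ?S = "discrete_image G g q"
  have "a \<in> {a \<in> edges Y. a \<subseteq> ?S}" if "e \<in> edges G" "a \<in> walk_edges (q e)" for e a
    using that walk_edges_subset_set[OF that(2)] discrete_wiring_walkD[OF dw1 that(1)]
    by (auto simp: walk_iff discrete_image_def)
  then have "(\<Union>e\<in>edges G. \<Union>a\<in>walk_edges (q e). set (p a))
      \<subseteq> (\<Union>a\<in>{a \<in> edges Y. a \<subseteq> ?S}. set (p a))"
    by blast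
  with q'(2) have "discrete_image G (r \<circ> g) q' \<subseteq> r ` ?S \<union> (\<Union>a\<in>{a \<in> edges Y. a \<subseteq> ?S}. set (p a))"
    by blast
  with Y d \<kappa> dw2 len finite_discrete_image[OF G] discrete_image_subset_verts[OF dw1]
  have card: "real (card (discrete_image G (r \<circ> g) q')) \<le> (\<kappa> + 1/2) * real d * real (card ?S)"
    by (rule expansion_card)
  have "wir l G Y' \<le> enat (card (discrete_image G (r \<circ> g) q'))"
    using G Y' discrete_wiring_mono[OF q'(1) l] by (rule wir_le_card_discrete_image)
  then have "ereal_of_enat (wir l G Y') \<le> ereal_of_enat (enat (card (discrete_image G (r \<circ> g) q')))"
    by (simp only: ereal_of_enat_le_iff)
  also have "\<dots> \<le> ereal ((\<kappa> + 1/2) * real d) * ereal_of_enat (enat (card ?S))"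
    using card by simp
  also have "\<dots> \<le> ereal ((\<kappa> + 1/2) * real d) * ereal_of_enat N"
    using \<kappa> N by (intro ereal_mult_left_mono) (simp_all only: ereal_of_enat_le_iff, simp)
  finally show ?thesis .
qed

section \<open>The image of a discrete wiring as a graph\<close>

text \<open>The image is made into a graph because it has to be one of the subgraphs of
  \<open>X\<close> over which the profile ranges.\<close>

definition discrete_image_graph :: "'a ugraph \<Rightarrow> ('a \<Rightarrow> 'b) \<Rightarrow> ('a set \<Rightarrow> 'b list) \<Rightarrow> 'b ugraph" where
  "discrete_image_graph G g q = UGraph (discrete_image G g q) (\<Union>e\<in>edges G. walk_edges (q e))"

lemma subgraph_discrete_image_graph:
  assumes "graph H" "discrete_wiring k G H g q"
  shows "subgraph (discrete_image_graph G g q) H"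
proof -
  have edges: "edges (discrete_image_graph G g q) \<subseteq> edges H"
    using discrete_wiring_walkD[OF assms(2)] by (auto simp: discrete_image_graph_def walk_iff)
  have "a \<subseteq> verts (discrete_image_graph G g q)" if "a \<in> edges (discrete_image_graph G g q)" for a
    using that walk_edges_subset_set
    by (fastforce simp: discrete_image_graph_def discrete_image_def)
  with edges assms(1) have "graph (discrete_image_graph G g q)" by (auto simp: graph_def)
  with edges discrete_image_subset_verts[OF assms(2)] show ?thesis
    by (simp add: subgraph_def discrete_image_graph_def)
qed

lemma discrete_wiring_onto_image_graph:
  assumes "graph H" "discrete_wiring k G H g q"
  shows "discrete_wiring k G (discrete_image_graph G g q) g q"
proof -
  let ?I = "discrete_image_graph G g q"
  have sub: "verts ?I \<subseteq> verts H" "edges ?I \<subseteq> edges H"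
    using subgraph_discrete_image_graph[OF assms] by (auto simp: subgraph_def)
  show ?thesis
    unfolding discrete_wiring_def
  proof (intro conjI ballI)
    show "g ` verts G \<subseteq> verts ?I" by (auto simp: discrete_image_graph_def discrete_image_def)
    fix e assume e: "e \<in> edges G"
    show "walk ?I (q e)"
      using discrete_wiring_walkD[OF assms(2) e] e
      by (auto simp: walk_iff discrete_image_graph_def discrete_image_def)
    show "\<exists>u v. e = {u, v} \<and> hd (q e) = g u \<and> last (q e) = g v"
      using discrete_wiring_endsE[OF assms(2) e] by blast
  qed (use sub discrete_wiring_vert_card[OF assms(2)] discrete_wiring_edge_card[OF assms(2)] in blast)+
qed

section \<open>Bounds for wiring profiles and the empty case\<close>

lemma wir_le_wir_profile:
  "subgraph G X \<Longrightarrow> finite (verts G) \<Longrightarrow> real (card (verts G)) \<le> t \<Longrightarrow> wir k G Y \<le> wir_profile k X Y t"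
  unfolding wir_profile_def by (rule SUP_upper) simp

text \<open>The conversion to \<open>ereal\<close> is moved inside the supremum over a nonempty
  index set; for \<open>n \<ge> 0\<close> the empty graph belongs to it.\<close>

lemma wir_profile_le:
  assumes "n \<ge> 0"
    and "\<And>G. subgraph G X \<Longrightarrow> finite (verts G) \<Longrightarrow> real (card (verts G)) \<le> n \<Longrightarrow>
           ereal_of_enat (wir l G Y) \<le> b"
  shows "ereal_of_enat (wir_profile l X Y n) \<le> b"
proof -
  let ?A = "{G. subgraph G X \<and> finite (verts G) \<and> real (card (verts G)) \<le> n}"
  have "UGraph {} {} \<in> ?A" using assms(1) by (simp add: subgraph_def graph_def)
  then have "?A \<noteq> {}" by blast
  then show ?thesis
    unfolding wir_profile_def by (subst ereal_of_enat_SUP) (auto intro!: SUP_least assms(2))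
qed

lemma wir_no_vertices:
  assumes "graph G" "verts G = {}" "graph Y"
  shows "wir l G Y = 0"
proof -
  have "edges G = {}" using assms by (auto simp: graph_def)
  then have "discrete_wiring l G Y undefined undefined" and "discrete_image G undefined undefined = {}"
    using assms by (simp_all add: discrete_wiring_def discrete_image_def)
  with assms have "wir l G Y \<le> enat 0"
    using wir_le_card_discrete_image by (metis card.empty finite.emptyI)
  then show ?thesis by (simp flip: zero_enat_def)
qed

lemma wir_profile_no_vertices:
  assumes "n \<ge> 0" "graph Y" "verts X = {}"
  shows "ereal_of_enat (wir_profile l X Y n) \<le> 0"
proof (rule wir_profile_le[OF assms(1)])
  fix G assume "subgraph G X"
  with assms(3) have "graph G" "verts G = {}" by (simp_all add: subgraph_def)
  then show "ereal_of_enat (wir l G Y) \<le> 0" by (simp add: wir_no_vertices assms(2))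
qed

text \<open>A single vertex of \<open>X\<close> is a subgraph that counts at \<open>t = 1\<close>,
  and a wiring must send it to a vertex of \<open>Y\<close>.\<close>

lemma no_vertices_of_finite_profile:
  assumes "wir_profile k X Y 1 \<noteq> \<infinity>" "graph Y" "verts Y = {}"
  shows "verts X = {}"
proof (rule ccontr)
  assume "verts X \<noteq> {}"
  then obtain x where x: "x \<in> verts X" by blast
  let ?G = "UGraph {x} {}"
  have G: "graph ?G" "finite (verts ?G)" "subgraph ?G X"
    using x by (auto simp: graph_def subgraph_def)
  have "wir k ?G Y \<le> wir_profile k X Y 1" by (rule wir_le_wir_profile) (use G in auto)
  with assms(1) have "wir k ?G Y \<noteq> \<infinity>" by (auto dest!: enat_ile)
  then obtain g q where "discrete_wiring k ?G Y g q"
    using wir_finite_discrete[OF G(1,2) assms(2)] by blast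
  then have "g x \<in> verts Y" by (rule discrete_wiring_vertD) simp
  with assms(3) show False by simp
qed

section \<open>Comparison of profiles under regular maps\<close>

theorem corollary1p16:
  fixes X :: "'a ugraph" and X' :: "'b ugraph" and Y :: "'c ugraph" and Y' :: "'d ugraph"
    and \<Delta> :: nat and \<kappa> :: real and rX :: "'b \<Rightarrow> 'a" and rY :: "'c \<Rightarrow> 'd"
  assumes "graph X" "graph X'" "graph Y" "graph Y'"
    and "max_degree_le X \<Delta>" "max_degree_le X' \<Delta>" "max_degree_le Y \<Delta>" "max_degree_le Y' \<Delta>"
    and "\<Delta> \<ge> 1"
    and "\<kappa> > 0"
    and "regular_map \<kappa> (verts X') (gdist X') (verts X) (gdist X) rX"
    and "regular_map \<kappa> (verts Y) (gdist Y) (verts Y') (gdist Y') rY"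
  shows "\<forall>k. (\<forall>t\<ge>0. wir_profile k X Y t \<noteq> \<infinity>) \<longrightarrow>
    (\<exists>l. \<forall>n::real. n \<ge> 0 \<longrightarrow>
       ereal_of_enat (wir_profile l X Y' n)
         \<le> ereal ((\<kappa> + 1/2) * real \<Delta>) * ereal_of_enat (wir_profile k X Y n) \<and>
       ereal_of_enat (wir_profile l X' Y' n)
         \<le> ereal ((\<kappa> + 1/2) * real \<Delta>) *
           ereal_of_enat (wir_profile k X Y ((\<kappa> + 1/2) * real \<Delta> * n)))"
proof (intro allI impI)
  note X = assms(1,5) and X' = assms(2,6) and Y = assms(3,7) and Y' = assms(4,8)
  note d = \<open>\<Delta> \<ge> 1\<close> and rX = assms(11) and rY = assms(12)
  let ?c = "(\<kappa> + 1/2) * real \<Delta>"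
  have c: "?c \<ge> 0" using \<open>\<kappa> > 0\<close> by simp
  fix k assume fin: "\<forall>t\<ge>0. wir_profile k X Y t \<noteq> \<infinity>"
  show "\<exists>l. \<forall>n::real. n \<ge> 0 \<longrightarrow>
       ereal_of_enat (wir_profile l X Y' n)
         \<le> ereal ?c * ereal_of_enat (wir_profile k X Y n) \<and>
       ereal_of_enat (wir_profile l X' Y' n)
         \<le> ereal ?c * ereal_of_enat (wir_profile k X Y (?c * n))"
  proof (cases "\<kappa> \<ge> 1")
    case False
    then have "verts X' = {}" "verts Y = {}"
      using regular_map_ge_1[OF rX] regular_map_ge_1[OF rY] by auto
    have "wir_profile k X Y 1 \<noteq> \<infinity>" using fin by simp
    from no_vertices_of_finite_profile[OF this Y(1) \<open>verts Y = {}\<close>] have "verts X = {}" .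
    \<comment> \<open>Both left-hand sides are 0 in this case, so nonnegativity of the right-hand
      sides suffices, and \<open>l = 0\<close> is taken.\<close>
    have rhs: "0 \<le> ereal ?c * ereal_of_enat N" for N
      using c by (simp add: ereal_of_enat_nonneg)
    show ?thesis
    proof (intro exI allI impI conjI)
      fix n :: real assume n: "n \<ge> 0"
      show "ereal_of_enat (wir_profile 0 X Y' n) \<le> ereal ?c * ereal_of_enat (wir_profile k X Y n)"
        using n Y'(1) \<open>verts X = {}\<close> by (rule wir_profile_no_vertices[THEN order_trans, OF _ _ _ rhs])
      show "ereal_of_enat (wir_profile 0 X' Y' n)
          \<le> ereal ?c * ereal_of_enat (wir_profile k X Y (?c * n))"
        using n Y'(1) \<open>verts X' = {}\<close> by (rule wir_profile_no_vertices[THEN order_trans, OF _ _ _ rhs])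
    qed
  next
    case \<kappa>: True
    obtain m p where p: "discrete_wiring m Y Y' rY p"
        "\<And>e. e \<in> edges Y \<Longrightarrow> real (length (p e)) \<le> 2 * \<kappa> + 1"
      using regular_map_discrete_wiring[OF Y Y' \<open>\<kappa> > 0\<close> rY] by metis
    obtain m' p' where p': "discrete_wiring m' X' X rX p'"
        "\<And>e. e \<in> edges X' \<Longrightarrow> real (length (p' e)) \<le> 2 * \<kappa> + 1"
      using regular_map_discrete_wiring[OF X' X \<open>\<kappa> > 0\<close> rX] by metis
    \<comment> \<open>The first multiplicity belongs to the route through \<open>Y\<close> to
      \<open>Y'\<close>, the second to the route through \<open>X\<close> and \<open>Y\<close> to
      \<open>Y'\<close>.\<close>
    define l where "l = max (m * k) (m * (k * m'))"
    note push = wir_push_le[OF _ _ Y Y'(1) d \<kappa> _ p]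
    show ?thesis
    proof (intro exI[of _ l] allI impI conjI)
      fix n :: real assume n: "n \<ge> 0"
      show "ereal_of_enat (wir_profile l X Y' n) \<le> ereal ?c * ereal_of_enat (wir_profile k X Y n)"
      proof (rule wir_profile_le[OF n])
        fix G assume G: "subgraph G X" "finite (verts G)" "real (card (verts G)) \<le> n"
        then have gr: "graph G" by (simp add: subgraph_def)
        have le: "wir k G Y \<le> wir_profile k X Y n" using G by (rule wir_le_wir_profile)
        moreover have "wir_profile k X Y n \<noteq> \<infinity>" using fin n by simp
        ultimately have "wir k G Y \<noteq> \<infinity>" by (auto dest!: enat_ile)
        with gr G(2) Y(1) obtain g q where "discrete_wiring k G Y g q"
            "enat (card (discrete_image G g q)) \<le> wir k G Y"
          by (rule wir_finite_discrete)
        with le show "ereal_of_enat (wir l G Y') \<le> ereal ?c * ereal_of_enat (wir_profile k X Y n)"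
          by (intro push[OF gr G(2)]) (auto simp: l_def)
      qed
      show "ereal_of_enat (wir_profile l X' Y' n)
          \<le> ereal ?c * ereal_of_enat (wir_profile k X Y (?c * n))"
      proof (rule wir_profile_le[OF n])
        fix G assume G: "subgraph G X'" "finite (verts G)" "real (card (verts G)) \<le> n"
        then have gr: "graph G" by (simp add: subgraph_def)
        let ?I = "discrete_image_graph G rX p'"
        have dwG: "discrete_wiring m' G X rX p'" using p'(1) G(1) by (rule discrete_wiring_subgraph)
        note I = subgraph_discrete_image_graph[OF X(1) dwG]
          and dwI = discrete_wiring_onto_image_graph[OF X(1) dwG]
        have grI: "graph ?I" and finI: "finite (verts ?I)"
          using I finite_discrete_image[OF gr G(2)] by (simp_all add: subgraph_def discrete_image_graph_def)
        \<comment> \<open>The expansion bound is applied in \<open>X'\<close> to the vertex set of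
          \<open>G\<close>: every edge of \<open>G\<close> is among the edges of \<open>X'\<close>
          inside that set.\<close>
        have "real (card (verts ?I)) \<le> ?c * real (card (verts G))"
        proof (rule expansion_card[OF X' d \<kappa> p' G(2)])
          show "verts G \<subseteq> verts X'" using G(1) by (simp add: subgraph_def)
          have "edges G \<subseteq> {a \<in> edges X'. a \<subseteq> verts G}"
            using G(1) by (auto simp: subgraph_def graph_def)
          then show "verts ?I \<subseteq> rX ` verts G \<union> (\<Union>a\<in>{a \<in> edges X'. a \<subseteq> verts G}. set (p' a))"
            by (auto simp: discrete_image_graph_def discrete_image_def)
        qed
        also have "\<dots> \<le> ?c * n" using G(3) c by (rule mult_left_mono)
        finally have le: "wir k ?I Y \<le> wir_profile k X Y (?c * n)"
          by (rule wir_le_wir_profile[OF I finI])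
        have "wir_profile k X Y (?c * n) \<noteq> \<infinity>" using fin c n by simp
        with le have "wir k ?I Y \<noteq> \<infinity>" by (auto dest!: enat_ile)
        with grI finI Y(1) obtain g q where gq: "discrete_wiring k ?I Y g q"
            "enat (card (discrete_image ?I g q)) \<le> wir k ?I Y"
          by (rule wir_finite_discrete)
        obtain q' where q': "discrete_wiring (k * m') G Y (g \<circ> rX) q'"
          "discrete_image G (g \<circ> rX) q' \<subseteq>
             g ` discrete_image G rX p' \<union> (\<Union>e\<in>edges G. \<Union>a\<in>walk_edges (p' e). set (q a))"
          using discrete_wiring_compose[OF dwI gq(1)] by blast
        \<comment> \<open>The walks \<open>q a\<close> that occur belong to edges of
          \<open>?I\<close>, so composing with \<open>g\<close> costs nothing beyond the image of
          \<open>?I\<close>. The expansion from \<open>X'\<close> to \<open>X\<close> therefore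
          enters only through the argument of the profile.\<close>
        have "discrete_image G (g \<circ> rX) q' \<subseteq> discrete_image ?I g q"
          using q'(2) unfolding discrete_image_def[of ?I] by (simp add: discrete_image_graph_def)
        then have "card (discrete_image G (g \<circ> rX) q') \<le> card (discrete_image ?I g q)"
          using finite_discrete_image[OF grI finI] by (intro card_mono)
        with gq(2) le have "enat (card (discrete_image G (g \<circ> rX) q')) \<le> wir_profile k X Y (?c * n)"
          by (meson enat_ord_simps(1) order_trans)
        with q'(1) show "ereal_of_enat (wir l G Y')
            \<le> ereal ?c * ereal_of_enat (wir_profile k X Y (?c * n))"
          by (intro push[OF gr G(2)]) (auto simp: l_def)
      qed
    qed
  qed
qed

end
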